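(* Let $d\ge 2$ be an integer, and consider inhomogeneous non-oriented Bernoulli bond percolation on $\mathbb{Z}^d$ with parameters $p_1,\dots,p_d\in[0,1)$. If $p_1+\cdots+p_d>3\log 2$, then $\theta_d(p_1,\dots,p_d)>0$.
   Context: Here $\log$ is the natural logarithm. Inhomogeneous non-oriented Bernoulli bond percolation on $\mathbb{Z}^d$ with parameters $p_1,\dots,p_d\in[0,1]$: let $e_1,\dots,e_d$ be the canonical vectors of $\mathbb{Z}^d$. For each $i=1,\dots,d$ let $E_i=\{\langle x,x\pm e_i\rangle: x\in\mathbb{Z}^d\}$ be the set of (undirected) nearest-neighbour edges parallel to $e_i$, and let $E(\mathbb{Z}^d)=\bigcup_{i}E_i$. Let $\{X_e\}_{e\in E(\mathbb{Z}^d)}$ be independent random variables such that $X_e$ has Bernoulli($p_i$) distribution whenever $e\in E_i$, and let $\mathbb{P}$ be the resulting product measure. An edge $e$ is open if $X_e=1$ and closed otherwise. For $x,y\in\mathbb{Z}^d$, write $x\leftrightarrow y$ if there are $x_0=x,x_1,\dots,x_n=y$ (with $n\ge 0$) such that each $\langle x_{j-1},x_j\rangle$ belongs to $E(\mathbb{Z}^d)$ and is open, $j=1,\dots,n$. The open cluster of the origin is $\mathcal{C}^d_0=\{x\in\mathbb{Z}^d: 0\leftrightarrow x\}$, with size $|\mathcal{C}^d_0|$, and $\theta_d(p_1,\dots,p_d):=\mathbb{P}(|\mathcal{C}^d_0|=\infty)$. *)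

theory Defs
  imports "HOL-Probability.Probability"
begin

text \<open>A point of $\mathbb{Z}^d$ is a function on all of \<open>nat\<close> that vanishes outside the
  coordinates \<open>0, ..., d - 1\<close>; coordinates and parameters are thus numbered from 0.\<close>

type_synonym point = "nat \<Rightarrow> int"

definition Zd :: "nat \<Rightarrow> point set" where
  "Zd d = {x. \<forall>i\<ge>d. x i = 0}"

definition origin :: point where
  "origin = (\<lambda>_. 0)"

text \<open>Undirected edges are two-element sets of points.\<close>

definition edges_dir :: "nat \<Rightarrow> nat \<Rightarrow> point set set" where
  "edges_dir d i = {{x, x(i := x i + s)} | x s. x \<in> Zd d \<and> s \<in> {1, -1}}"

definition edges :: "nat \<Rightarrow> point set set" where
  "edges d = (\<Union>i<d. edges_dir d i)"

text \<open>Each edge lies in exactly one class \<open>edges_dir d i\<close>, see \<open>direction_eq\<close> below.\<close>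

definition direction :: "nat \<Rightarrow> point set \<Rightarrow> nat" where
  "direction d e = (THE i. i < d \<and> e \<in> edges_dir d i)"

text \<open>A configuration \<open>w\<close> assigns \<open>True\<close> to the open edges.\<close>

definition percolation :: "nat \<Rightarrow> (nat \<Rightarrow> real) \<Rightarrow> (point set \<Rightarrow> bool) measure" where
  "percolation d p = (\<Pi>\<^sub>M e\<in>edges d. measure_pmf (bernoulli_pmf (p (direction d e))))"

definition connected_by_open ::
  "nat \<Rightarrow> (point set \<Rightarrow> bool) \<Rightarrow> point \<Rightarrow> point \<Rightarrow> bool" where
  "connected_by_open d w x y \<longleftrightarrow>
     (\<exists>(n::nat) (v::nat \<Rightarrow> point). v 0 = x \<and> v n = y \<and>
        (\<forall>j<n. {v j, v (Suc j)} \<in> edges d \<and> w {v j, v (Suc j)}))"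

definition cluster :: "nat \<Rightarrow> (point set \<Rightarrow> bool) \<Rightarrow> point set" where
  "cluster d w = {x \<in> Zd d. connected_by_open d w origin x}"

definition theta :: "nat \<Rightarrow> (nat \<Rightarrow> real) \<Rightarrow> real" where
  "theta d p = measure (percolation d p) {w \<in> space (percolation d p). infinite (cluster d w)}"

lemma edges_dir_disjoint:
  assumes "e \<in> edges_dir d i" "e \<in> edges_dir d j"
  shows "i = j"
proof (rule ccontr)
  assume ne: "i \<noteq> j"
  obtain x s where x: "e = {x, x(i := x i + s)}" and s: "s \<in> {1, -1::int}"
    using assms(1) unfolding edges_dir_def by blast
  obtain y t where y: "e = {y, y(j := y j + t)}" and t: "t \<in> {1, -1::int}"
    using assms(2) unfolding edges_dir_def by blast
  have i: "u i \<noteq> v i" if "u \<in> e" "v \<in> e" "u \<noteq> v" for u v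
    using that s unfolding x by auto
  have "y \<noteq> y(j := y j + t)"
    using t by (auto simp: fun_eq_iff)
  from i[OF _ _ this] have "y i \<noteq> (y(j := y j + t)) i"
    unfolding y by blast
  with ne show False by simp
qed

lemma direction_eq:
  assumes "i < d" "e \<in> edges_dir d i"
  shows "direction d e = i"
  unfolding direction_def using assms edges_dir_disjoint by blast

lemma prob_space_percolation: "prob_space (percolation d p)"
  unfolding percolation_def by (intro prob_space_PiM measure_pmf.prob_space_axioms)

lemma countable_Zd: "countable (Zd d)"
proof -
  have "Zd d \<subseteq> (\<lambda>xs i. if i < d then xs ! i else 0) ` (UNIV :: int list set)"
  proof
    fix x assume "x \<in> Zd d"
    then have "x = (\<lambda>i. if i < d then map x [0..<d] ! i else 0)"
      by (auto simp: Zd_def fun_eq_iff)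
    then show "x \<in> (\<lambda>xs i. if i < d then xs ! i else 0) ` (UNIV :: int list set)"
      by blast
  qed
  then show ?thesis
    by (rule countable_subset) simp
qed

lemma edges_subset_Zd:
  assumes "{x, y} \<in> edges d"
  shows "x \<in> Zd d" "y \<in> Zd d"
proof -
  have "{x, y} \<subseteq> Zd d"
    using assms by (auto simp: edges_def edges_dir_def Zd_def doubleton_eq_iff)
  then show "x \<in> Zd d" "y \<in> Zd d" by auto
qed

lemma connected_by_open_Suc_iff:
  "(\<exists>v. v 0 = x \<and> v (Suc n) = y \<and>
        (\<forall>j<Suc n. {v j, v (Suc j)} \<in> edges d \<and> w {v j, v (Suc j)})) \<longleftrightarrow>
   (\<exists>z\<in>Zd d. (\<exists>v. v 0 = x \<and> v n = z \<and>
        (\<forall>j<n. {v j, v (Suc j)} \<in> edges d \<and> w {v j, v (Suc j)})) \<and>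
      {z, y} \<in> edges d \<and> w {z, y})" (is "?L \<longleftrightarrow> ?R")
proof
  assume ?L
  then show ?R using edges_subset_Zd(1) by (metis lessI less_SucI)
next
  assume ?R
  then obtain z v where v: "v 0 = x" "v n = z" "{z, y} \<in> edges d" "w {z, y}"
    "\<And>j. j < n \<Longrightarrow> {v j, v (Suc j)} \<in> edges d \<and> w {v j, v (Suc j)}" by blast
  then show ?L
    by (intro exI[of _ "v(Suc n := y)"]) (auto simp: less_Suc_eq)
qed

lemma measurable_infinite_cluster:
  "{w \<in> space (percolation d p). infinite (cluster d w)} \<in> sets (percolation d p)"
proof -
  let ?M = "percolation d p"
  have open_edge: "Measurable.pred ?M (\<lambda>w. e \<in> edges d \<and> w e)" for e
  proof (cases "e \<in> edges d")
    case True
    have "(\<lambda>w. w e) \<in> ?M \<rightarrow>\<^sub>M measure_pmf (bernoulli_pmf (p (direction d e)))"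
      unfolding percolation_def by (rule measurable_component_singleton[OF True])
    then have "Measurable.pred ?M (\<lambda>w. w e)"
      by (simp cong: measurable_cong_sets)
    then show ?thesis using True by simp
  qed simp
  have path: "Measurable.pred ?M (\<lambda>w. \<exists>v. v 0 = x \<and> v n = y \<and>
      (\<forall>j<n. {v j, v (Suc j)} \<in> edges d \<and> w {v j, v (Suc j)}))" for n x y
  proof (induction n arbitrary: y)
    case 0
    show ?case by simp
  next
    case (Suc n)
    show ?case
      unfolding connected_by_open_Suc_iff
      by (intro measurable_pred_countable(2) countable_Zd pred_intros_logic(3) Suc open_edge)
  qed
  have conn: "Measurable.pred ?M (\<lambda>w. connected_by_open d w x y)" for x y
    unfolding connected_by_open_def by (intro pred_intros_countable(2) path)
  have "infinite (cluster d w) \<longleftrightarrow>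
      (\<forall>A\<in>{A. finite A \<and> A \<subseteq> Zd d}. \<exists>x\<in>Zd d - A. connected_by_open d w origin x)"
    (is "_ \<longleftrightarrow> ?R") for w
  proof
    assume inf: "infinite (cluster d w)"
    show ?R
    proof
      fix A assume "A \<in> {A. finite A \<and> A \<subseteq> Zd d}"
      with inf have "\<not> cluster d w \<subseteq> A" using finite_subset by auto
      then show "\<exists>x\<in>Zd d - A. connected_by_open d w origin x"
        by (auto simp: cluster_def)
    qed
  next
    assume ?R
    then show "infinite (cluster d w)"
      by (force simp: cluster_def)
  qed
  moreover have "countable {A. finite A \<and> A \<subseteq> Zd d}"
    by (rule countable_Collect_finite_subset[OF countable_Zd])
  ultimately have "Measurable.pred ?M (\<lambda>w. infinite (cluster d w))"
    by (simp only:) (intro measurable_pred_countable countable_Diff countable_Zd conn)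
  then show ?thesis by (simp add: pred_def)
qed

end

theory Submission
  imports Defs "HOL-Library.Transitive_Closure_Table"
begin

text \<open>Split the coordinates into three groups and map the unit vectors of the groups to the three
  generators of the triangular lattice. Exploring the cluster of the origin bond by bond, and
  examining only bonds that lead to an unvisited vertex of the triangular lattice, one sees at least
  percolation on that lattice in which an edge of direction \<open>j\<close> is closed with probability
  \<open>w\<^sub>j\<close>, the product of \<open>1 - p\<^sub>i\<close> over group \<open>j\<close>. If the exploration stops, a closed contour runs
  along the dual hexagonal lattice. The transfer matrix of non-backtracking walks there has spectral
  radius less than 1 exactly if the sum of \<open>w\<^sub>j / (1 + w\<^sub>j)\<close> is less than 1, which is the
  borderline case \<open>w\<^sub>j = 1/2\<close> at total mass \<open>3 * ln 2\<close>; a balanced partition satisfies it. Hence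
  long contours are unlikely, and a long initial segment of open bonds forces contours to be long.\<close>

section \<open>Balanced partitions into three groups\<close>

text \<open>With \<open>w = exp (- t)\<close> one has \<open>w / (1 + w) = logistic t\<close>, so
  the criterion asks that the logistic values of the three group masses sum to less than 1, the mass
  of a coordinate being \<open>- ln (1 - p i)\<close>. The obstacle is that masses can rarely be
  split evenly, and convexity makes unevenness costly. What compensates is that the hypothesis
  bounds the sum of the \<open>p i\<close>, not of the masses: in an optimal partition a group
  exceeds the lightest one by \<delta> only if each of its members of positive mass has mass at
  least \<delta>, and for such members \<open>1 - exp (- a)\<close> falls well short of
  \<open>a\<close>. In the exploration, a bond found open takes its projected edge off the boundary
  for good. An edge that ends on the boundary has therefore cost one closed bond for every
  coordinate of its group, in whatever order the bonds were examined; this bounds each fixed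
  contour, and a union bound finishes. The contour is extracted by parity counts, which work for
  every finite set and replace a Jordan curve argument.\<close>

definition logistic :: "real \<Rightarrow> real" where
  "logistic t = 1 / (1 + exp t)"

lemma logistic_less_iff: "logistic s < logistic t \<longleftrightarrow> t < s"
  by (simp add: logistic_def divide_simps add_pos_pos)

lemma logistic_values: "logistic 0 = 1/2" "logistic (ln 2) = 1/3" "logistic (2 * ln 2) = 1/5"
  by (simp_all add: logistic_def exp_double)

lemma convex_logistic: "convex_on {0..} logistic"
proof (rule convex_on_realI[where f' = "\<lambda>t. - exp t / (1 + exp t)^2"])
  show "(logistic has_real_derivative - exp t / (1 + exp t)^2) (at t)" for t
  proof -
    have "1 + exp t \<noteq> 0" using exp_gt_zero[of t] by linarith
    then show ?thesis
      unfolding logistic_def[abs_def]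
      by (auto intro!: derivative_eq_intros simp: power2_eq_square)
  qed
  fix s t :: real assume st: "s \<in> {0..}" "t \<in> {0..}" "s \<le> t"
  have E: "1 \<le> exp s" "exp s \<le> exp t" using st by auto
  have "exp s * exp t \<ge> 1" using E by (metis mult_mono mult_1 dual_order.trans zero_le_one)
  \<comment> \<open>Expanded, this product is the difference of the two sides of the next
    inequality.\<close>
  then have "(exp t - exp s) * (exp s * exp t - 1) \<ge> 0" using E by simp
  then have "exp t * (1 + exp s)^2 \<le> exp s * (1 + exp t)^2"
    by (simp add: power2_eq_square algebra_simps)
  then have "exp t / (1 + exp t)^2 \<le> exp s / (1 + exp s)^2"
    using exp_gt_zero[of s] exp_gt_zero[of t] by (simp add: frac_le_eq divide_simps add_nonneg_eq_0_iff)
  then show "- exp s / (1 + exp s)^2 \<le> - exp t / (1 + exp t)^2" by simp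
qed auto

lemma logistic_chord:
  assumes "0 \<le> a" "a < b" "a \<le> t" "t \<le> b"
  shows "logistic t \<le> ((b - t) * logistic a + (t - a) * logistic b) / (b - a)"
proof -
  let ?u = "(t - a) / (b - a)"
  have u: "0 \<le> ?u" "?u \<le> 1" using assms by (auto simp: divide_simps)
  have t: "(1 - ?u) * a + ?u * b = t"
  proof -
    have "(1 - ?u) * a + ?u * b = a + ?u * (b - a)"
      by (simp only: left_diff_distrib right_diff_distrib)
    then show ?thesis using assms by simp
  qed
  have "logistic ((1 - ?u) *\<^sub>R a + ?u *\<^sub>R b) \<le> (1 - ?u) * logistic a + ?u * logistic b"
    by (rule convex_onD[OF convex_logistic]) (use u assms in auto)
  moreover have "(1 - ?u) = (b - t) / (b - a)" using assms by (simp add: field_simps)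
  ultimately show ?thesis using t by (simp add: add_divide_distrib)
qed

text \<open>The values at 0, \<open>ln 2\<close> and \<open>2 * ln 2\<close> are rational, so chords
  between these points turn the transcendental criterion into linear arithmetic in units of
  \<open>ln 2\<close>.\<close>

lemma logistic_chord_low:
  assumes "0 \<le> t" "t \<le> 1"
  shows "logistic (t * ln 2) \<le> 1/2 - t/6"
proof -
  have "logistic (t * ln 2) \<le> ((ln 2 - t * ln 2) * logistic 0 + (t * ln 2 - 0) * logistic (ln 2)) / (ln 2 - 0)"
    by (rule logistic_chord) (use assms in auto)
  also have "\<dots> = 1/2 - t/6" by (simp add: logistic_values field_simps)
  finally show ?thesis .
qed

lemma logistic_chord_high:
  assumes "1 \<le> t" "t \<le> 2"
  shows "logistic (t * ln 2) \<le> 1/3 - 2/15 * (t - 1)"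
proof -
  have "logistic (t * ln 2) \<le> ((2 * ln 2 - t * ln 2) * logistic (ln 2) + (t * ln 2 - ln 2) * logistic (2 * ln 2)) / (2 * ln 2 - ln 2)"
    by (rule logistic_chord) (use assms in auto)
  also have "\<dots> = 1/3 - 2/15 * (t - 1)"
    by (simp add: logistic_values field_simps)
  finally show ?thesis .
qed

lemma logistic_transfer:
  assumes "0 < a" "t + a < s" "0 \<le> t"
  shows "logistic (s - a) + logistic (t + a) < logistic s + logistic t"
proof -
  define A S T where "A = exp a" and "S = exp (s - a)" and "T = exp t"
  have A: "A > 1" and ST: "T < S" and T: "1 \<le> T"
    using assms by (auto simp: A_def S_def T_def)
  have e: "exp s = S * A" "exp (t + a) = T * A"
    by (simp_all add: A_def S_def T_def exp_diff exp_add)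
  have m: "S * A * T > 1"
  proof -
    have "S * A > 1" using A ST T by (meson less_1_mult order_le_less_trans)
    then show ?thesis using T by (metis less_1_mult mult.right_neutral order_le_less)
  qed
  \<comment> \<open>Clearing denominators in the claim leaves exactly this factorised
    difference.\<close>
  have "0 < (A - 1) * (S - T) * (S * A * T - 1)" using A ST m by simp
  then have "(2 + S + T * A) * ((1 + S * A) * (1 + T)) < (2 + S * A + T) * ((1 + S) * (1 + T * A))"
    by (simp add: algebra_simps)
  then have "(2 + S + T * A) / ((1 + S) * (1 + T * A)) < (2 + S * A + T) / ((1 + S * A) * (1 + T))"
    using A ST T by (simp add: divide_simps add_pos_pos mult.commute)
  moreover have "logistic (s - a) + logistic (t + a) = (2 + S + T * A) / ((1 + S) * (1 + T * A))"
    using A ST T by (simp add: logistic_def e(2) S_def[symmetric] add_frac_eq add_pos_pos add_nonneg_eq_0_iff)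
  moreover have "logistic s + logistic t = (2 + S * A + T) / ((1 + S * A) * (1 + T))"
    using A ST T by (simp add: logistic_def e(1) T_def[symmetric] add_frac_eq add_pos_pos add_nonneg_eq_0_iff)
  ultimately show ?thesis by simp
qed

text \<open>A member of mass \<open>a\<close> has probability \<open>1 - exp (- a)\<close>, so a
  lower bound on its mass gives a uniform saving factor. The case \<open>\<delta> = a\<close> comes
  from the Pade bound \<open>exp a \<le> (2 + a) / (2 - a)\<close>, proved without the denominator
  so as to cover \<open>a \<ge> 2\<close> as well.\<close>

lemma one_minus_exp_le:
  fixes a \<delta> :: real
  assumes "0 \<le> \<delta>" "a = 0 \<or> \<delta> \<le> a"
  shows "1 - exp (- a) \<le> a * (2 / (2 + \<delta>))"
proof -
  have key: "(2 - t) * exp t \<le> 2 + t" if "0 \<le> t" for t :: real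
  proof -
    have "(\<lambda>t. (2 - t) * exp t - (2 + t)) t \<le> (\<lambda>t. (2 - t) * exp t - (2 + t)) 0"
    proof (rule DERIV_nonpos_imp_nonincreasing[OF that])
      fix s :: real assume "0 \<le> s" "s \<le> t"
      have "(1 - s) * exp s \<le> exp (-s) * exp s"
        using exp_ge_add_one_self[of "-s"] by (intro mult_right_mono) auto
      then have "(1 - s) * exp s \<le> 1" by (simp add: exp_minus)
      then show "\<exists>y. ((\<lambda>t. (2 - t) * exp t - (2 + t)) has_real_derivative y) (at s) \<and> y \<le> 0"
        by (intro exI[of _ "(1 - s) * exp s - 1"] conjI)
           (auto intro!: derivative_eq_intros simp: algebra_simps)
    qed
    then show ?thesis by simp
  qed
  show ?thesis
  proof (cases "a = 0")
    case False
    then have a: "\<delta> \<le> a" "0 \<le> a" using assms by auto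
    have "(2 - a) \<le> (2 + a) * exp (-a)"
      using key[OF a(2)] by (simp add: exp_minus field_simps)
    then have "1 - exp (- a) \<le> 2 * a / (2 + a)"
      using a by (simp add: field_simps)
    also have "\<dots> \<le> a * (2 / (2 + \<delta>))"
      using a assms(1) by (simp add: divide_simps mult_left_mono)
    finally show ?thesis .
  qed simp
qed

text \<open>The three arguments are the logarithmic masses of the groups of a partition, in decreasing
  order; \<open>Px\<close>, \<open>Py\<close>, \<open>Pz\<close> are the corresponding sums of probabilities. The disjunctions
  separate groups with a single essential member from groups with at least two.\<close>

lemma logistic_sum_less_one:
  fixes x y z Px Py Pz :: real
  assumes ord: "x \<ge> y" "y \<ge> z" "z \<ge> 0"
    and Px: "Px \<le> x * (2 / (2 + (x - z)))" "Px \<le> 1 - exp (-x) \<or> 2 * (x - z) \<le> x"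
    and Py: "Py \<le> y * (2 / (2 + (y - z)))" "Py \<le> 1 - exp (-y) \<or> 2 * (y - z) \<le> y"
    and Pz: "Pz \<le> z"
    and total: "Px + Py + Pz > 3 * ln 2"
  shows "logistic x + logistic y + logistic z < 1"
proof (cases "z \<le> ln 2")
  case False
  then have "logistic z < 1/3" "logistic y < 1/3" "logistic x < 1/3"
    using ord by (auto simp: logistic_less_iff simp flip: logistic_values)
  then show ?thesis by linarith
next
  case zL: True
  define L :: real where "L = ln 2"
  have L: "2/3 \<le> L" "0 < L" using ln2_ge_two_thirds by (auto simp: L_def)
  define x' y' z' where "x' = x / L" and "y' = y / L" and "z' = z / L"
  have eq: "x = x' * L" "y = y' * L" "z = z' * L"
    using L by (simp_all add: x'_def y'_def z'_def)
  have ord': "x' \<ge> y'" "y' \<ge> z'" "z' \<ge> 0" "z' \<le> 1"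
    using ord zL L by (simp_all add: x'_def y'_def z'_def divide_right_mono flip: L_def)
  have le: "t * (2 / (2 + (t - z))) \<le> t" if "t \<ge> z" for t
    using that ord by (intro mult_left_le) (auto simp: divide_simps)
  have Px1: "Px \<le> x" and Py1: "Py \<le> y" using le[of x] le[of y] Px(1) Py(1) ord by auto
  have "x > L" using Px1 Py1 Pz total ord by (simp add: L_def)
  then have x1: "x' > 1" using L by (simp add: x'_def)
  have gz: "logistic z \<le> 1/2 - z'/6"
    using logistic_chord_low[of z'] ord' eq by (simp add: L_def)
  have gy: "logistic y \<le> 1/2 - y'/6" if "y' \<le> 1"
    using logistic_chord_low[of y'] ord' eq that by (simp add: L_def)
  have gy2: "logistic y \<le> 1/3 - 2/15 * (y' - 1)" if "y' \<ge> 1" "y' \<le> 2"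
    using logistic_chord_high[of y'] ord' eq that by (simp add: L_def)
  show ?thesis
  proof (cases "2 * (x - z) \<le> x")
    case True
    then have x2: "x' \<le> 2 * z'" using L eq by (simp add: algebra_simps flip: distrib_right)
    have gx: "logistic x \<le> 1/3 - 2/15 * (x' - 1)"
      using logistic_chord_high[of x'] x1 x2 ord' eq by (simp add: L_def)
    have "1/2 * (2/3) \<le> z' * L" using x1 x2 L by (intro mult_mono) auto
    then have z3: "1/3 \<le> z" using eq by simp
    have z2: "z \<le> 2" using zL ln_2_less_1 by linarith
    \<comment> \<open>At \<open>t = z\<close> the left side has slope \<open>(2 - z) / 2\<close>,
      which is at most 5/6 because \<open>z \<ge> 1/3\<close>.\<close>
    have lin: "t * (2 / (2 + (t - z))) \<le> z + 5/6 * (t - z)" if "t \<ge> z" for t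
    proof -
      define \<delta> where "\<delta> = t - z"
      have d: "\<delta> \<ge> 0" "t = z + \<delta>" using that by (auto simp: \<delta>_def)
      have "0 \<le> \<delta> * (6 * (z - 1/3) + 5 * \<delta>)" using d z3 by simp
      then have "(z + \<delta>) * 2 \<le> (z + 5/6 * \<delta>) * (2 + \<delta>)"
        unfolding distrib_left distrib_right left_diff_distrib right_diff_distrib
        by (simp add: mult.commute mult.left_commute)
      then have "(z + \<delta>) * 2 / (2 + \<delta>) \<le> z + 5/6 * \<delta>"
        using d by (subst pos_divide_le_eq) auto
      then have "(z + \<delta>) * (2 / (2 + \<delta>)) \<le> z + 5/6 * \<delta>" by simp
      then show ?thesis by (simp add: d)
    qed
    have "Px \<le> z + 5/6 * (x - z)" "Py \<le> z + 5/6 * (y - z)"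
      by (rule order.trans[OF Px(1) lin] order.trans[OF Py(1) lin]; use ord in linarith)+
    then have "3 * z + 5/6 * ((x - z) + (y - z)) > 3 * L"
      using Pz total unfolding L_def by argo
    also have "3 * z + 5/6 * ((x - z) + (y - z)) = L * (3 * z' + 5/6 * (x' + y' - 2 * z'))"
      by (simp add: eq field_simps)
    finally have "L * (3 * z' + 5/6 * (x' + y' - 2 * z')) > L * 3"
      by (simp add: mult.commute)
    then have main: "3 * z' + 5/6 * (x' + y' - 2 * z') > 3" using L by simp
    show ?thesis
    proof (cases "y' \<ge> 1")
      case True
      have "y' \<le> 2" using x2 ord' by linarith
      from gy2[OF True this] have "logistic x + logistic y + logistic z \<le> 7/6 - 2/15 * (x' + y' - 2) - z'/6"
        using gx gz by argo
      moreover have "x' + y' - 2 > 8/5 * (1 - z')" using main by argo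
      ultimately show ?thesis using ord' by argo
    next
      case False
      then show ?thesis using gx gz gy[OF less_imp_le[OF False[unfolded not_le]]] main x2 ord' by argo
    qed
  next
    case False
    define u where "u = exp (-x)"
    have "u \<le> exp (- ln 2)" using \<open>x > L\<close> by (simp add: u_def L_def)
    then have u: "0 < u" "u \<le> 1/2" by (simp_all add: u_def exp_minus)
    have Pxu: "Px \<le> 1 - u" using Px(2) False by (simp add: u_def)
    have gxu: "logistic x = u / (1 + u)"
      by (simp add: logistic_def u_def exp_minus field_simps add_pos_pos)
    \<comment> \<open>This square yields the tangent of \<open>u / (1 + u)\<close> at
      \<open>u = 1/2\<close>, the value of \<open>u\<close> at \<open>x = ln 2\<close>.\<close>
    have "0 \<le> (2 * u - 1)^2" by simp
    then have "9 * u \<le> (1 + 4 * u) * (1 + u)" by (simp add: power2_eq_square algebra_simps)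
    then have gx: "logistic x \<le> 1/9 + 4/9 * u"
      using u by (simp add: gxu field_simps)
    show ?thesis
    proof (cases "2 * (y - z) \<le> y")
      case True
      then have y2: "y' \<le> 2 * z'" using L eq by (simp add: algebra_simps flip: distrib_right)
      have "y + z > 3 * L - (1 - u)" using Pxu Py1 Pz total by (simp add: L_def)
      moreover have "1 - u \<le> 3/2 * (1 - u) * L" using mult_left_mono[OF L(1), of "3/2 * (1 - u)"] u by simp
      moreover have "y + z = L * (y' + z')" by (simp add: eq algebra_simps)
      ultimately have "L * (y' + z') > L * 3 - 3/2 * (1 - u) * L" by linarith
      also have "L * 3 - 3/2 * (1 - u) * L = L * (3 - 3/2 * (1 - u))" by (simp add: field_simps)
      finally have "L * (y' + z') > L * (3 - 3/2 * (1 - u))" .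
      then have T: "y' + z' > 3 - 3/2 * (1 - u)" using L by simp
      show ?thesis
      proof (cases "y' \<ge> 1")
        case True
        have "y' \<le> 2" using y2 ord' by linarith
        note gy2[OF True this]
        \<comment> \<open>The constant 13/90 is the best one under \<open>y' \<le> 2 * z'\<close>,
          with equality at \<open>y' = 2 * z'\<close>.\<close>
        moreover have "2/15 * y' + 1/6 * z' \<ge> 13/90 * (y' + z')" using y2 by argo
        ultimately show ?thesis using gx gz T u by argo
      next
        case False
        then show ?thesis using gx gz gy[OF less_imp_le[OF False[unfolded not_le]]] T y2 ord' u by argo
      qed
    next
      case False
      define v where "v = exp (-y)"
      have v: "0 < v" by (simp add: v_def)
      have Pyv: "Py \<le> 1 - v" using Py(2) False by (simp add: v_def)
      have gyv: "logistic y = v / (1 + v)"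
        by (simp add: logistic_def v_def exp_minus field_simps add_pos_pos)
      \<comment> \<open>Two groups give at most \<open>1 - u\<close> and \<open>1 - v\<close> and
        the third at most \<open>ln 2\<close>, so \<open>u + v < 2 - 2 * ln 2\<close>. At
        \<open>u = v = 1/3\<close> the first two logistic values sum to exactly 1/2, which is what
        the third leaves.\<close>
      have "u + v < 2/3" using Pxu Pyv Pz total zL L by (simp add: L_def)
      moreover have "(u - v)^2 \<ge> 0" by simp
      ultimately have "4 * (u + v) + 12 * (u * v) < 4"
      proof -
        have "12 * (u * v) \<le> 3 * (u + v)^2"
          using \<open>(u - v)^2 \<ge> 0\<close> by (simp add: power2_eq_square algebra_simps)
        also have "\<dots> \<le> 3 * ((u + v) * (2/3))"
          using u v \<open>u + v < 2/3\<close> unfolding power2_eq_square by (intro mult_left_mono) auto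
        also have "\<dots> = 2 * (u + v)" by simp
        finally show ?thesis using \<open>u + v < 2/3\<close> by argo
      qed
      then have "u / (1 + u) + v / (1 + v) < 1/2"
        using u v by (simp add: add_frac_eq divide_simps add_pos_pos) (simp add: algebra_simps)
      then show ?thesis using gxu gyv gz ord' by linarith
    qed
  qed
qed

text \<open>Members of mass 0 have probability 0. If at most one other member remains, its
  probability is a function of the group mass alone; two others have mass at least \<delta> each.
  The product bound is the saving factor applied member by member.\<close>

lemma group_bound:
  fixes a :: "'a \<Rightarrow> real"
  assumes "finite S" "0 \<le> \<delta>" and a: "\<And>i. i \<in> S \<Longrightarrow> a i = 0 \<or> \<delta> \<le> a i \<and> 0 < a i"
  shows "(\<Sum>i\<in>S. 1 - exp (- a i)) \<le> sum a S * (2 / (2 + \<delta>))"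
    and "(\<Sum>i\<in>S. 1 - exp (- a i)) \<le> 1 - exp (- sum a S) \<or> 2 * \<delta> \<le> sum a S"
proof -
  have "(\<Sum>i\<in>S. 1 - exp (- a i)) \<le> (\<Sum>i\<in>S. a i * (2 / (2 + \<delta>)))"
    using a assms(2) by (intro sum_mono one_minus_exp_le) auto
  then show "(\<Sum>i\<in>S. 1 - exp (- a i)) \<le> sum a S * (2 / (2 + \<delta>))"
    by (simp only: sum_distrib_right)
  have nonneg: "\<And>i. i \<in> S \<Longrightarrow> 0 \<le> a i" using a by force
  show "(\<Sum>i\<in>S. 1 - exp (- a i)) \<le> 1 - exp (- sum a S) \<or> 2 * \<delta> \<le> sum a S"
  proof (cases "\<exists>i\<in>S. \<forall>k\<in>S - {i}. a k = 0")
    case True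
    then obtain i where i: "i \<in> S" "\<And>k. k \<in> S - {i} \<Longrightarrow> a k = 0" by blast
    have "sum h S = h i" if "\<And>k. a k = 0 \<Longrightarrow> h k = 0" for h :: "'a \<Rightarrow> real"
      using i that assms(1) by (simp add: sum.remove[of S i])
    from this[of a] this[of "\<lambda>i. 1 - exp (- a i)"] show ?thesis by simp
  next
    case False
    show ?thesis
    proof (cases "S = {}")
      case True
      then show ?thesis by simp
    next
      case ne: False
      then obtain i where i: "i \<in> S" "a i \<noteq> 0" using False by (metis DiffD1 all_not_in_conv)
      with False obtain k where k: "k \<in> S" "k \<noteq> i" "a k \<noteq> 0" by auto
      have "2 * \<delta> \<le> sum a {i, k}" using a[of i] a[of k] i k by auto
      also have "\<dots> \<le> sum a S"
        using i k nonneg assms(1) by (intro sum_mono2) auto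
      finally show ?thesis by simp
    qed
  qed
qed

definition closed_weight :: "nat \<Rightarrow> (nat \<Rightarrow> real) \<Rightarrow> (nat \<Rightarrow> nat) \<Rightarrow> nat \<Rightarrow> real" where
  "closed_weight d p f j = (\<Prod>i | i < d \<and> f i = j. 1 - p i)"

text \<open>A partition minimising the sum of the logistic functions of the three masses is balanced:
  no member can be moved to a lighter group with a gain.\<close>

lemma exists_partition:
  fixes p :: "nat \<Rightarrow> real"
  assumes p: "\<And>i. i < d \<Longrightarrow> 0 \<le> p i \<and> p i < 1" and total: "(\<Sum>i<d. p i) > 3 * ln 2"
  obtains f where "\<And>i. i < d \<Longrightarrow> f i < 3" "closed_weight d p f 0 < 1"
    "(\<Sum>j<3. closed_weight d p f j / (1 + closed_weight d p f j)) < 1"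
proof -
  define a where "a i = - ln (1 - p i)" for i
  define S where "S f j = {i. i < d \<and> f i = j}" for f :: "nat \<Rightarrow> nat" and j
  define X where "X f j = sum a (S f j)" for f j
  define cost where "cost f = (\<Sum>j<3. logistic (X f j))" for f
  have fin: "finite (S f j)" for f j by (simp add: S_def)
  have a0: "0 \<le> a i" if "i < d" for i using p[OF that] by (simp add: a_def)
  have pa: "p i = 1 - exp (- a i)" if "i < d" for i using p[OF that] by (simp add: a_def)
  have X0: "0 \<le> X f j" for f j unfolding X_def by (intro sum_nonneg) (auto simp: S_def a0)
  have weight: "closed_weight d p f j = exp (- X f j)" for f j
    unfolding closed_weight_def X_def S_def by (simp add: exp_sum pa flip: sum_negf)
  have weight_logistic: "closed_weight d p f j / (1 + closed_weight d p f j) = logistic (X f j)" for f j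
    unfolding weight logistic_def by (simp add: exp_minus field_simps add_pos_pos)
  define F where "F = {..<d} \<rightarrow>\<^sub>E {..<3::nat}"
  have "finite F" "F \<noteq> {}" unfolding F_def by (auto intro!: finite_PiE simp: PiE_eq_empty_iff lessThan_empty_iff)
  then obtain f where f: "f \<in> F" "\<And>f'. f' \<in> F \<Longrightarrow> cost f \<le> cost f'"
    using ex_min_if_finite[of "cost ` F"] by (metis (no_types, lifting) finite_imageI image_iff image_is_empty not_le)
  have f3: "f i < 3" if "i < d" for i using f(1) that by (auto simp: F_def)
  have balanced: "a i = 0 \<or> X f j - X f k \<le> a i \<and> 0 < a i"
    if i: "i \<in> S f j" and k: "k < 3" "k \<noteq> j" for i j k
  proof (rule ccontr)
    assume "\<not> ?thesis"
    moreover have id: "i < d" "f i = j" using i by (auto simp: S_def)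
    ultimately have ai: "0 < a i" "X f k + a i < X f j" using a0[of i] by auto
    let ?f = "f(i := k)"
    have j3: "j < 3" using f3 id by auto
    have "?f \<in> F" using f(1) k id by (auto simp: F_def PiE_def extensional_def)
    then have "cost f \<le> cost ?f" by (rule f(2))
    moreover have "S ?f j = S f j - {i}" "S ?f k = insert i (S f k)" and i': "i \<notin> S f k"
      and oth: "\<And>l. l \<noteq> j \<Longrightarrow> l \<noteq> k \<Longrightarrow> S ?f l = S f l"
      using id k by (auto simp: S_def)
    then have XX: "X ?f j = X f j - a i" "X ?f k = X f k + a i"
      "\<And>l. l \<noteq> j \<Longrightarrow> l \<noteq> k \<Longrightarrow> X ?f l = X f l"
      using fin i by (simp_all add: X_def sum_diff1)
    have split: "(\<Sum>l<3. h l) = h j + h k + (\<Sum>l\<in>{..<3} - {j, k}. h l)" for h :: "nat \<Rightarrow> real"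
      using sum.subset_diff[of "{j, k}" "{..<3}" h] j3 k by simp
    have "cost ?f < cost f"
      unfolding cost_def split using XX logistic_transfer[OF ai(1) ai(2) X0] by simp
    ultimately show False by simp
  qed
  obtain j0 j1 j2 where j: "{..<3} = {j0, j1, j2}" "j0 \<noteq> j1" "j1 \<noteq> j2" "j0 \<noteq> j2"
    and ord: "X f j0 \<ge> X f j1" "X f j1 \<ge> X f j2"
  proof -
    fix thesis
    assume *: "\<And>j0 j1 j2. {..<3} = {j0, j1, j2} \<Longrightarrow> j0 \<noteq> j1 \<Longrightarrow> j1 \<noteq> j2 \<Longrightarrow> j0 \<noteq> j2 \<Longrightarrow>
      X f j0 \<ge> X f j1 \<Longrightarrow> X f j1 \<ge> X f j2 \<Longrightarrow> thesis"
    have perm: thesis if "{j0, j1, j2} = {0, 1, 2}" "j0 \<noteq> j1" "j1 \<noteq> j2" "j0 \<noteq> j2"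
      "X f j0 \<ge> X f j1" "X f j1 \<ge> X f j2" for j0 j1 j2
    proof -
      have "{..<3::nat} = {0, 1, 2}" by auto
      then show thesis using that by (intro *[of j0 j1 j2]) auto
    qed
    consider "X f 0 \<ge> X f 1" "X f 1 \<ge> X f 2" | "X f 0 \<ge> X f 2" "X f 2 \<ge> X f 1"
      | "X f 1 \<ge> X f 0" "X f 0 \<ge> X f 2" | "X f 1 \<ge> X f 2" "X f 2 \<ge> X f 0"
      | "X f 2 \<ge> X f 0" "X f 0 \<ge> X f 1" | "X f 2 \<ge> X f 1" "X f 1 \<ge> X f 0"
      by linarith
    then show thesis
    proof cases
      case 1
      then show ?thesis by (intro perm[of 0 1 2]) auto
    next
      case 2
      then show ?thesis by (intro perm[of 0 2 1]) auto
    next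
      case 3
      then show ?thesis by (intro perm[of 1 0 2]) auto
    next
      case 4
      then show ?thesis by (intro perm[of 1 2 0]) auto
    next
      case 5
      then show ?thesis by (intro perm[of 2 0 1]) auto
    next
      case 6
      then show ?thesis by (intro perm[of 2 1 0]) auto
    qed
  qed
  have j3: "j0 < 3" "j1 < 3" "j2 < 3" using j(1) by auto
  define P where "P k = (\<Sum>i\<in>S f k. 1 - exp (- a i))" for k
  have "(\<Sum>k<3. \<Sum>i | i \<in> {..<d} \<and> f i = k. p i) = (\<Sum>i<d. p i)"
    by (rule sum.group) (auto simp: f3)
  moreover have "(\<Sum>i | i \<in> {..<d} \<and> f i = k. p i) = P k" for k
    unfolding P_def S_def by (intro sum.cong) (auto simp: pa)
  ultimately have "(\<Sum>k<3. P k) > 3 * ln 2" using total by simp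
  then have Ptotal: "P j0 + P j1 + P j2 > 3 * ln 2" using j by simp
  have Pz: "P j2 \<le> X f j2"
  proof -
    have "1 - exp (- a i) \<le> a i" for i
      using exp_ge_add_one_self[of "- a i"] by linarith
    then show ?thesis unfolding P_def X_def by (rule sum_mono)
  qed
  have group_x: "P j0 \<le> X f j0 * (2 / (2 + (X f j0 - X f j2)))"
    "P j0 \<le> 1 - exp (- X f j0) \<or> 2 * (X f j0 - X f j2) \<le> X f j0"
    unfolding P_def X_def
    by (rule group_bound; use fin ord balanced[of _ j0 j2] j j3 in \<open>auto simp: X_def\<close>)+
  have group_y: "P j1 \<le> X f j1 * (2 / (2 + (X f j1 - X f j2)))"
    "P j1 \<le> 1 - exp (- X f j1) \<or> 2 * (X f j1 - X f j2) \<le> X f j1"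
    unfolding P_def X_def
    by (rule group_bound; use fin ord balanced[of _ j1 j2] j j3 in \<open>auto simp: X_def\<close>)+
  have less: "logistic (X f j0) + logistic (X f j1) + logistic (X f j2) < 1"
    by (rule logistic_sum_less_one[OF ord X0 group_x group_y Pz Ptotal])
  \<comment> \<open>Relabelling makes group 0 the heaviest. Its mass is positive, so it contains a
    coordinate that is open with positive probability; the initial segment will run along such a
    coordinate.\<close>
  define g where "g i = (if f i = j0 then 0 else if f i = j1 then 1 else (2::nat))" for i
  have "f i \<in> {j0, j1, j2}" if "i < d" for i using f3[OF that] j(1) by auto
  then have Sg: "S g 0 = S f j0" "S g 1 = S f j1" "S g 2 = S f j2"
    using j by (auto simp: S_def g_def)
  have Xg: "X g 0 = X f j0" "X g (Suc 0) = X f j1" "X g 2 = X f j2"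
    using Sg by (simp_all add: X_def)
  show thesis
  proof (rule that[of g])
    show "g i < 3" for i by (simp add: g_def)
    show "(\<Sum>j<3. closed_weight d p g j / (1 + closed_weight d p g j)) < 1"
    proof -
      have "(\<Sum>j<3. h j) = h 0 + h (Suc 0) + h 2" for h :: "nat \<Rightarrow> real"
        by (simp add: numeral_3_eq_3 numeral_2_eq_2)
      then show ?thesis unfolding weight_logistic using less by (simp only: Xg)
    qed
    have "X f j0 > 0"
    proof (rule ccontr)
      assume "\<not> ?thesis"
      then have "X f j0 = 0" "X f j1 = 0" "X f j2 = 0" using ord X0[of f j0] X0[of f j1] X0[of f j2] by auto
      with less show False by (simp add: logistic_values)
    qed
    then show "closed_weight d p g 0 < 1" by (simp add: weight Xg)
  qed
qed

section \<open>Contours in the triangular lattice\<close>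

text \<open>\<open>(v, j)\<close> names the edge between \<open>v\<close> and
  \<open>v + gen j\<close>; only positive generators occur, so each edge has one name.\<close>

type_synonym tri_edge = "(int \<times> int) \<times> nat"

definition gen :: "nat \<Rightarrow> int \<times> int" where
  "gen j = (if j = 0 then (1, 0) else if j = 1 then (0, 1) else (1, 1))"

definition boundary :: "(int \<times> int) set \<Rightarrow> tri_edge set" where
  "boundary A = {(v, j). j < 3 \<and> (v \<in> A \<longleftrightarrow> v + gen j \<notin> A)}"

text \<open>The unit square with lower left vertex \<open>u\<close> is cut by its diagonal;
  \<open>True\<close> selects the triangle below it, \<open>False\<close> the one above. These
  triangles are the vertices of the dual hexagonal lattice. Each edge lies in one triangle of each
  type, and \<open>corner\<close> finds its base vertex.\<close>

definition face :: "int \<times> int \<Rightarrow> bool \<Rightarrow> tri_edge set" where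
  "face u b = (if b then {(u, 0), (u + gen 0, 1), (u, 2)} else {(u, 1), (u + gen 1, 0), (u, 2)})"

definition corner :: "tri_edge \<Rightarrow> bool \<Rightarrow> int \<times> int" where
  "corner e b = (if snd e = (if b then 1 else 0) then fst e - gen (if b then 0 else 1) else fst e)"

lemma face_iff_corner: "snd e < 3 \<Longrightarrow> e \<in> face u b \<longleftrightarrow> corner e b = u"
  by (cases e) (auto simp: face_def corner_def numeral_3_eq_3 less_Suc_eq)

lemma finite_face: "finite (face u b)"
  by (simp add: face_def)

lemma face_snd: "e \<in> face u b \<Longrightarrow> snd e < 3"
  by (auto simp: face_def split: if_splits)

lemma sum_face: "(\<Sum>e\<in>face u b. h (snd e)) = (\<Sum>j<3. h j)"
  for h :: "nat \<Rightarrow> 'a :: comm_monoid_add"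
  by (auto simp: face_def numeral_3_eq_3 numeral_2_eq_2 add_ac)

lemma card_Int_face:
  "card (K \<inter> face u True) = of_bool ((u, 0) \<in> K) + of_bool ((u + gen 0, 1) \<in> K) + of_bool ((u, 2) \<in> K)"
  "card (K \<inter> face u False) = of_bool ((u, 1) \<in> K) + of_bool ((u + gen 1, 0) \<in> K) + of_bool ((u, 2) \<in> K)"
proof -
  have "card (K \<inter> face u b) = (\<Sum>e\<in>face u b. of_bool (e \<in> K))" for b
    by (simp add: finite_face Int_commute)
  then show
    "card (K \<inter> face u True) = of_bool ((u, 0) \<in> K) + of_bool ((u + gen 0, 1) \<in> K) + of_bool ((u, 2) \<in> K)"
    "card (K \<inter> face u False) = of_bool ((u, 1) \<in> K) + of_bool ((u + gen 1, 0) \<in> K) + of_bool ((u, 2) \<in> K)"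
    by (simp_all add: face_def del: sum_of_bool_eq)
qed

text \<open>Going once around a triangle, membership in \<open>A\<close> changes an even number of
  times.\<close>

lemma even_boundary_face: "even (card (boundary A \<inter> face u b))"
  by (cases u; cases b) (auto simp: card_Int_face boundary_def gen_def)

lemma card_boundary_face_le: "card (boundary A \<inter> face u b) \<le> 2"
proof -
  have "card (boundary A \<inter> face u b) \<le> card (face u b)"
    by (intro card_mono finite_face) auto
  also have "\<dots> \<le> 3" by (auto simp: face_def card_insert_if)
  finally show ?thesis using even_boundary_face[of A u b] by presburger
qed

lemma finite_boundary: assumes "finite A" shows "finite (boundary A)"
proof (rule finite_subset)
  show "boundary A \<subseteq> (\<lambda>(v, j). (v, j)) ` (A \<times> {..<3}) \<union> (\<lambda>(v, j). (v - gen j, j)) ` (A \<times> {..<3})"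
    by (force simp: boundary_def image_iff)
qed (use assms in auto)

section \<open>Boundary arcs and their crossings with the horizontal axis\<close>

definition adjacent :: "(int \<times> int) set \<Rightarrow> tri_edge \<Rightarrow> tri_edge \<Rightarrow> bool" where
  "adjacent A e e' \<longleftrightarrow> e \<in> boundary A \<and> e' \<in> boundary A \<and> e \<noteq> e' \<and> (\<exists>b. corner e b = corner e' b)"

lemma adjacent_rtranclp_boundary: "(adjacent A)\<^sup>*\<^sup>* e e' \<Longrightarrow> e \<in> boundary A \<Longrightarrow> e' \<in> boundary A"
  by (induction rule: rtranclp_induct) (auto simp: adjacent_def)

lemma boundary_snd: "e \<in> boundary A \<Longrightarrow> snd e < 3"
  by (auto simp: boundary_def)

text \<open>The triangles of the strip between the heights \<open>y\<close> and \<open>y + 1\<close> form a path, so the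
  numbers of horizontal edges of \<open>K\<close> at these heights have the same parity.\<close>

lemma even_line_crossings:
  assumes "finite K" and even: "\<And>u b. even (card (K \<inter> face u b))"
  shows "even (card {k. ((k, 0), 0) \<in> K})"
proof -
  define c :: "int \<Rightarrow> int \<Rightarrow> nat \<Rightarrow> nat" where "c x y j = of_bool (((x, y), j) \<in> K)" for x y j
  have "finite ((\<lambda>e. \<bar>fst (fst e)\<bar> + \<bar>snd (fst e)\<bar>) ` K)" using assms(1) by simp
  then obtain M' where "\<And>e. e \<in> K \<Longrightarrow> \<bar>fst (fst e)\<bar> + \<bar>snd (fst e)\<bar> \<le> M'"
    by (meson bdd_above.unfold bdd_above_finite image_eqI)
  then obtain M where M: "\<And>e. e \<in> K \<Longrightarrow> \<bar>fst (fst e)\<bar> + \<bar>snd (fst e)\<bar> < M"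
    by (metis zless_add1_eq order_le_less)
  have c0: "c x y j = 0" if "\<bar>x\<bar> \<ge> M \<or> \<bar>y\<bar> \<ge> M" for x y j
    using M[of "((x, y), j)"] that by (auto simp: c_def)
  define H where "H y = (\<Sum>x=-M..M. c x y 0)" for y
  \<comment> \<open>Adding the two triangles of a square counts the diagonal twice, so it drops out
    modulo 2.\<close>
  have local: "even (c x y 0 + c x (y + 1) 0 + (c x y 1 + c (x + 1) y 1))" for x y
    using even[of "(x, y)" True] even[of "(x, y)" False] unfolding card_Int_face
    by (auto simp: gen_def c_def of_bool_def split: if_splits)
  have shift: "(\<Sum>x=-M..M. c (x + 1) y 1) = (\<Sum>x=-M..M. c x y 1)" for y
  proof -
    have "(\<Sum>x=-M..M. c (x + 1) y 1) = (\<Sum>x=-M+1..M+1. c x y 1)"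
      by (rule sum.reindex_bij_witness[of _ "\<lambda>x. x - 1" "\<lambda>x. x + 1"]) auto
    also have "\<dots> = (\<Sum>x=-M-1..M+1. c x y 1)"
    proof (rule sum.mono_neutral_left; clarsimp)
      fix x assume "-M - 1 \<le> x" "x \<le> M + 1" "\<not> 1 - M \<le> x"
      then show "c x y (Suc 0) = 0" by (intro c0) linarith
    qed
    also have "\<dots> = (\<Sum>x=-M..M. c x y 1)"
      by (rule sum.mono_neutral_right) (auto intro!: c0)
    finally show ?thesis .
  qed
  have step: "even (H y) \<longleftrightarrow> even (H (y + 1))" for y
  proof -
    have "even (\<Sum>x=-M..M. c x y 0 + c x (y + 1) 0 + (c x y 1 + c (x + 1) y 1))"
      by (intro dvd_sum local)
    then have "even (H y + H (y + 1) + ((\<Sum>x=-M..M. c x y 1) + (\<Sum>x=-M..M. c (x + 1) y 1)))"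
      by (simp only: sum.distrib H_def)
    then show ?thesis unfolding shift by auto
  qed
  have "even (H 0) \<longleftrightarrow> even (H (int n))" for n
  proof (induction n)
    case (Suc n)
    then show ?case using step[of "int n"] by (simp add: add.commute)
  qed simp
  \<comment> \<open>The height \<open>M + 1\<close> lies above all of \<open>K\<close>, where the
    count is 0.\<close>
  from this[of "nat (M + 1)"] have "even (H 0)" by (simp add: H_def c0)
  moreover have "H 0 = card ({-M..M} \<inter> {k. ((k, 0), 0) \<in> K})" by (simp add: H_def c_def)
  moreover have "{-M..M} \<inter> {k. ((k, 0), 0) \<in> K} = {k. ((k, 0), 0) \<in> K}"
    using M by force
  ultimately show ?thesis by simp
qed

lemma odd_card_changes:
  fixes P :: "nat \<Rightarrow> bool"
  shows "odd (card {k. k < n \<and> P k \<noteq> P (Suc k)}) \<longleftrightarrow> P 0 \<noteq> P n"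
proof (induction n)
  case (Suc n)
  have "{k. k < Suc n \<and> P k \<noteq> P (Suc k)} =
      (if P n \<noteq> P (Suc n) then insert n {k. k < n \<and> P k \<noteq> P (Suc k)} else {k. k < n \<and> P k \<noteq> P (Suc k)})"
    by (auto simp: less_Suc_eq)
  then show ?case using Suc by auto
qed simp

text \<open>Along the ray, membership in \<open>A\<close> starts true and is eventually false
  because \<open>A\<close> is finite.\<close>

lemma odd_ray_crossings:
  assumes "finite A" "(0, 0) \<in> A"
  shows "odd (card {k. 0 \<le> k \<and> ((k, 0), 0) \<in> boundary A})"
proof -
  define P where "P k \<longleftrightarrow> (int k, 0) \<in> A" for k
  have "finite ((\<lambda>v. nat (fst v)) ` A)" using assms by simp
  then obtain m where m: "\<And>v. v \<in> A \<Longrightarrow> nat (fst v) \<le> m"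
    by (meson bdd_above.unfold bdd_above_finite image_eqI)
  have Pm: "\<not> P k" if "k > m" for k using m[of "(int k, 0)"] that by (auto simp: P_def)
  have "{k. 0 \<le> k \<and> ((k, 0), 0) \<in> boundary A} = int ` {k. k < Suc m \<and> P k \<noteq> P (Suc k)}"
  proof safe
    fix k :: int assume k: "0 \<le> k" "((k, 0), 0) \<in> boundary A"
    then have *: "P (nat k) \<noteq> P (Suc (nat k))"
      by (auto simp: boundary_def gen_def P_def add.commute)
    then have "nat k < Suc m" using Pm[of "nat k"] Pm[of "Suc (nat k)"] by force
    with * k show "k \<in> int ` {k. k < Suc m \<and> P k \<noteq> P (Suc k)}"
      by (intro image_eqI[of _ _ "nat k"]) auto
  qed (auto simp: P_def boundary_def gen_def add.commute)
  then have "card {k. 0 \<le> k \<and> ((k, 0), 0) \<in> boundary A} = card {k. k < Suc m \<and> P k \<noteq> P (Suc k)}"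
    by (simp add: card_image)
  then show ?thesis
    using odd_card_changes[of "Suc m" P] Pm[of "Suc m"] assms(2) by (simp add: P_def)
qed

text \<open>The component of the boundary that meets the positive ray an odd number of times meets the
  whole line an even number of times, hence also the negative ray.\<close>

lemma exists_boundary_arc:
  assumes "finite A" "(0, 0) \<in> A"
  obtains k k' where "0 \<le> k" "k' < 0" "((k, 0), 0) \<in> boundary A"
    "(adjacent A)\<^sup>*\<^sup>* ((k, 0), 0) ((k', 0), 0)"
proof (rule ccontr)
  assume none: "\<not> thesis"
  define K where "K = {e'. \<exists>k\<ge>0. ((k, 0), 0) \<in> boundary A \<and> (adjacent A)\<^sup>*\<^sup>* ((k, 0), 0) e'}"
  have KA: "K \<subseteq> boundary A" by (auto simp: K_def dest: adjacent_rtranclp_boundary)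
  \<comment> \<open>\<open>K\<close> is closed under adjacency, so a triangle has all of its
    boundary edges in \<open>K\<close> or none.\<close>
  have "even (card (K \<inter> face u b))" for u b
  proof (cases "K \<inter> face u b = {}")
    case False
    then obtain e where e: "e \<in> K" "e \<in> face u b" by blast
    have "e' \<in> K" if "e' \<in> boundary A \<inter> face u b" for e'
    proof (cases "e' = e")
      case False
      have "adjacent A e e'"
        using e that KA False face_iff_corner[of e u b] face_iff_corner[of e' u b]
        unfolding adjacent_def by (metis IntE face_snd subsetD)
      then show ?thesis using e(1) by (auto simp: K_def intro: rtranclp.rtrancl_into_rtrancl)
    qed (use e in simp)
    then have "K \<inter> face u b = boundary A \<inter> face u b" using KA by auto
    then show ?thesis by (simp add: even_boundary_face)
  qed simp
  moreover have "finite K" using KA finite_boundary[OF assms(1)] by (rule finite_subset)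
  ultimately have "even (card {k. ((k, 0), 0) \<in> K})" by (intro even_line_crossings)
  moreover have "{k. ((k, 0), 0) \<in> K} = {k. 0 \<le> k \<and> ((k, 0), 0) \<in> boundary A}"
  proof (intro Collect_cong iffI)
    fix k assume kK: "((k, 0), 0) \<in> K"
    then obtain k0 where "0 \<le> k0" "((k0, 0), 0) \<in> boundary A" "(adjacent A)\<^sup>*\<^sup>* ((k0, 0), 0) ((k, 0), 0)"
      by (auto simp: K_def)
    then have "0 \<le> k" using none that[of k0 k] by force
    with kK show "0 \<le> k \<and> ((k, 0), 0) \<in> boundary A" using KA by auto
  qed (auto simp: K_def)
  ultimately show False using odd_ray_crossings[OF assms] by simp
qed

text \<open>Non-backtracking walks on the dual hexagonal lattice that leave \<open>e\<close> through
  its triangle of type \<open>b\<close>. The types alternate because an edge separates two triangles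
  of different types. The starting edge is not listed and carries no weight.\<close>

primrec walks :: "nat \<Rightarrow> tri_edge \<Rightarrow> bool \<Rightarrow> tri_edge list set" where
  "walks 0 e b = {[]}"
| "walks (Suc n) e b = (\<Union>e'\<in>face (corner e b) b - {e}. (#) e' ` walks n e' (\<not> b))"

lemma finite_walks: "finite (walks n e b)"
  by (induction n arbitrary: e b) (auto simp: finite_face)

text \<open>The transfer matrix of the walks maps the vector with entries \<open>1 / (1 + w j)\<close> to at most
  \<open>\<mu>\<close> times itself.\<close>

lemma sum_walk_weights:
  fixes w :: "nat \<Rightarrow> real"
  assumes w: "\<And>j. 0 \<le> w j" "\<And>j. w j \<le> 1"
    and mu: "\<mu> = (\<Sum>j<3. w j / (1 + w j))" "\<mu> \<le> 1" and "snd e < 3"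
  shows "(\<Sum>l\<in>walks n e b. \<Prod>\<gamma>\<leftarrow>l. w (snd \<gamma>)) \<le> 2 * \<mu> ^ n / (1 + w (snd e))"
  using \<open>snd e < 3\<close>
proof (induction n arbitrary: e b)
  case 0
  \<comment> \<open>The factor 2 in the bound is there to absorb
    \<open>1 + w j \<le> 2\<close>.\<close>
  show ?case using w[of "snd e"] by (simp add: field_simps)
next
  case (Suc n)
  define T where "T = face (corner e b) b"
  have T: "finite T" "e \<in> T" using Suc.prems by (simp_all add: T_def finite_face face_iff_corner)
  have T3: "snd e' < 3" if "e' \<in> T - {e}" for e' using that by (simp add: T_def face_snd[of e' "corner e b" b])
  have w1: "1 + w j > 0" for j using w(1)[of j] by linarith
  have mu0: "0 \<le> \<mu>" unfolding mu using w1 w by (intro sum_nonneg) (simp add: less_imp_le)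
  have "(\<Sum>l\<in>walks (Suc n) e b. \<Prod>\<gamma>\<leftarrow>l. w (snd \<gamma>))
      = (\<Sum>e'\<in>T - {e}. \<Sum>l\<in>(#) e' ` walks n e' (\<not> b). \<Prod>\<gamma>\<leftarrow>l. w (snd \<gamma>))"
    unfolding walks.simps T_def[symmetric] using T by (intro sum.UNION_disjoint) (auto simp: finite_walks)
  also have "\<dots> = (\<Sum>e'\<in>T - {e}. w (snd e') * (\<Sum>l\<in>walks n e' (\<not> b). \<Prod>\<gamma>\<leftarrow>l. w (snd \<gamma>)))"
    by (subst sum.reindex) (auto simp: sum_distrib_left)
  also have "\<dots> \<le> (\<Sum>e'\<in>T - {e}. w (snd e') * (2 * \<mu> ^ n / (1 + w (snd e'))))"
    using T3 w by (intro sum_mono mult_left_mono Suc.IH) auto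
  also have "\<dots> = 2 * \<mu> ^ n * (\<Sum>e'\<in>T - {e}. w (snd e') / (1 + w (snd e')))"
    by (simp add: sum_distrib_left mult_ac)
  also have "\<dots> \<le> 2 * \<mu> ^ n * (\<mu> / (1 + w (snd e)))"
  proof (rule mult_left_mono)
    have "(\<Sum>e'\<in>T - {e}. w (snd e') / (1 + w (snd e'))) = \<mu> - w (snd e) / (1 + w (snd e))"
      using sum_face[of "\<lambda>j. w j / (1 + w j)" "corner e b" b] T
      by (simp add: sum_diff1 mu T_def)
    \<comment> \<open>Multiplied by \<open>1 + w j\<close>, this reads
      \<open>\<mu> * w j \<le> w j\<close>; here \<open>\<mu> \<le> 1\<close> enters.\<close>
    also have "\<dots> \<le> \<mu> / (1 + w (snd e))"
    proof -
      have "w (snd e) * \<mu> \<le> w (snd e)" using mu(2) w(1) by (intro mult_left_le) auto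
      then have "(\<mu> * (1 + w (snd e)) - w (snd e)) / (1 + w (snd e)) \<le> \<mu> / (1 + w (snd e))"
        using w1[of "snd e"] by (intro divide_right_mono) (auto simp: algebra_simps)
      then show ?thesis using w1[of "snd e"] by (simp add: diff_divide_distrib)
    qed
    finally show "(\<Sum>e'\<in>T - {e}. w (snd e') / (1 + w (snd e'))) \<le> \<mu> / (1 + w (snd e))" .
  qed (use mu0 in simp)
  finally show ?case by (simp add: mult_ac)
qed

text \<open>A triangle contains at most two boundary edges, so three distinct consecutive edges of
  the path cannot share one. Hence the path changes the type of triangle at each step, as a
  non-backtracking walk does.\<close>

lemma adjacent_path_walk:
  assumes "rtrancl_path (adjacent A) e l e'" "distinct (e # l)" "n \<le> length l"
    "l \<noteq> [] \<Longrightarrow> corner (hd l) b = corner e b"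
  shows "take n l \<in> walks n e b"
  using assms
proof (induction arbitrary: n b rule: rtrancl_path.induct)
  case (step e e1 l z)
  show ?case
  proof (cases n)
    case (Suc m)
    have adj: "e \<in> boundary A" "e1 \<in> boundary A" "e \<noteq> e1"
      using step.hyps(1) by (auto simp: adjacent_def)
    have e1: "e1 \<in> face (corner e b) b"
      using step.prems(3) boundary_snd[OF adj(2)] by (simp add: face_iff_corner)
    have "corner (hd l) (\<not> b) = corner e1 (\<not> b)" if "l \<noteq> []"
    proof -
      obtain e2 l' where l: "l = e2 # l'" using \<open>l \<noteq> []\<close> by (cases l) auto
      have "adjacent A e1 e2" using step.hyps(2) l by (auto elim: rtrancl_path.cases)
      then obtain b' where b': "corner e1 b' = corner e2 b'" "e2 \<in> boundary A"
        by (auto simp: adjacent_def)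
      have "b' \<noteq> b"
      proof
        assume "b' = b"
        then have "{e, e1, e2} \<subseteq> boundary A \<inter> face (corner e b) b"
          using b' adj e1 step.prems(3) by (auto simp: face_iff_corner boundary_snd)
        then have "card {e, e1, e2} \<le> 2"
          using card_boundary_face_le card_mono finite_face finite_Int le_trans by meson
        moreover have "card {e, e1, e2} = 3" using step.prems(1) l by auto
        ultimately show False by simp
      qed
      then show ?thesis using b' l by (cases b; cases b') auto
    qed
    then have "take m l \<in> walks m e1 (\<not> b)"
      using step.prems Suc by (intro step.IH) auto
    then show ?thesis using Suc e1 adj by auto
  qed simp
qed simp

text \<open>Edges of a common triangle have base points whose abscissas differ by at most 1, so an
  arc to the negative ray must be long.\<close>

lemma adjacent_path_length:
  assumes "rtrancl_path (adjacent A) e l e'"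
  shows "fst (fst e) \<le> fst (fst e') + int (length l)" "set l \<subseteq> boundary A"
  using assms
proof (induction rule: rtrancl_path.induct)
  case (step e e1 l z)
  {
    case 1
    have "fst (fst e) \<le> fst (fst e1) + 1"
      using step.hyps(1) by (auto simp: adjacent_def corner_def gen_def prod_eq_iff split: if_splits)
    then show ?case using step.IH by simp
  next
    case 2
    then show ?case using step by (auto simp: adjacent_def)
  }
qed auto

text \<open>An arc from the crossing at abscissa \<open>n\<close> to the negative ray has at least
  \<open>n\<close> steps. Cutting it after exactly \<open>n\<close> steps makes the starting edge a
  function of the length, so no sum over starting positions arises. The segment inside
  \<open>A\<close> excludes crossings with \<open>n < N\<close>.\<close>

lemma exists_boundary_walk:
  assumes "finite A" and seg: "\<And>k. k \<le> N \<Longrightarrow> (int k, 0) \<in> A"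
  obtains n b l where "n \<ge> N" "l \<in> walks n ((int n, 0), 0) b" "distinct l" "set l \<subseteq> boundary A"
proof -
  obtain k k' where k: "0 \<le> k" "k' < 0" "((k, 0), 0) \<in> boundary A"
      "(adjacent A)\<^sup>*\<^sup>* ((k, 0), 0) ((k', 0), 0)"
    using exists_boundary_arc[OF assms(1)] seg[of 0] by auto
  then obtain l where l: "rtrancl_path (adjacent A) ((k, 0), 0) l ((k', 0), 0)" "distinct (((k, 0), 0) # l)"
    unfolding rtranclp_eq_rtrancl_path by (metis rtrancl_path_distinct)
  have len: "nat k \<le> length l" using adjacent_path_length(1)[OF l(1)] k by simp
  obtain b where b: "l \<noteq> [] \<Longrightarrow> corner (hd l) b = corner ((k, 0), 0) b"
  proof (cases l)
    case Nil
    then show thesis by (intro that[of True]) simp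
  next
    case (Cons e1 l')
    then have "adjacent A ((k, 0), 0) e1" using l(1) by (auto elim: rtrancl_path.cases)
    then obtain b where "corner ((k, 0), 0) b = corner e1 b" by (auto simp: adjacent_def)
    then show thesis using Cons by (intro that[of b]) simp
  qed
  have "take (nat k) l \<in> walks (nat k) ((int (nat k), 0), 0) b"
    using adjacent_path_walk[OF l len b] k(1) by simp
  moreover have "N \<le> nat k"
  proof (rule ccontr)
    assume "\<not> N \<le> nat k"
    then have "(k, 0) \<in> A" "(k + 1, 0) \<in> A" using seg[of "nat k"] seg[of "Suc (nat k)"] k(1)
      by (auto simp: add.commute)
    then show False using k(3) by (simp add: boundary_def gen_def)
  qed
  moreover have "distinct (take (nat k) l)" using l(2) by simp
  moreover have "set (take (nat k) l) \<subseteq> boundary A"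
    using adjacent_path_length(2)[OF l(1)] set_take_subset by fastforce
  ultimately show thesis using that by blast
qed

section \<open>Exploration of the cluster\<close>

definition bond :: "point \<Rightarrow> nat \<Rightarrow> point set" where
  "bond x i = {x, x(i := x i + 1)}"

lemma bond_eq_iff: "bond x i = bond y k \<longleftrightarrow> x = y \<and> i = k"
proof
  assume eq: "bond x i = bond y k"
  have up: "x = y" if "x = y(k := y k + 1)" "y = x(i := x i + 1)"
  proof -
    have "x k = (y(k := y k + 1)) k" using that(1) by (rule fun_cong)
    moreover have "y k = (x(i := x i + 1)) k" using that(2) by (rule fun_cong)
    ultimately show ?thesis by (simp split: if_splits)
  qed
  have "(x = y \<and> x(i := x i + 1) = y(k := y k + 1)) \<or> (x = y(k := y k + 1) \<and> x(i := x i + 1) = y)"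
    using eq unfolding bond_def doubleton_eq_iff .
  then have "x = y" "x(i := x i + 1) = y(k := y k + 1)" using up by metis+
  then show "x = y \<and> i = k" by (auto simp: fun_eq_iff split: if_splits)
qed simp

lemma bond_edges_dir: "x \<in> Zd d \<Longrightarrow> bond x i \<in> edges_dir d i"
  unfolding bond_def edges_dir_def by auto

lemma bond_in_edges: "x \<in> Zd d \<Longrightarrow> i < d \<Longrightarrow> bond x i \<in> edges d"
  using bond_edges_dir by (auto simp: edges_def)

lemma direction_bond: "x \<in> Zd d \<Longrightarrow> i < d \<Longrightarrow> direction d (bond x i) = i"
  by (intro direction_eq bond_edges_dir)

lemma Zd_upd: "x \<in> Zd d \<Longrightarrow> i < d \<Longrightarrow> x(i := z) \<in> Zd d"
  by (simp add: Zd_def)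

section \<open>Independence of a single edge in the product measure\<close>

lemma space_percolation: "space (percolation d p) = extensional (edges d)"
  by (auto simp: percolation_def space_PiM PiE_def extensional_def)

lemma space_percolation_upd:
  "w \<in> space (percolation d p) \<Longrightarrow> e \<in> edges d \<Longrightarrow> w(e := b) \<in> space (percolation d p)"
  by (auto simp: space_percolation extensional_def)

lemma open_edge_measurable:
  assumes "e \<in> edges d"
  shows "{w \<in> space (percolation d p). w e} \<in> sets (percolation d p)"
proof -
  have "(\<lambda>w. w e) \<in> percolation d p \<rightarrow>\<^sub>M measure_pmf (bernoulli_pmf (p (direction d e)))"
    unfolding percolation_def by (rule measurable_component_singleton[OF assms])
  then have "Measurable.pred (percolation d p) (\<lambda>w. w e)"
    by (simp cong: measurable_cong_sets)
  then show ?thesis by (simp add: pred_def)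
qed

text \<open>Split off the factor of \<open>e\<close>: an event insensitive to \<open>e\<close> is a
  cylinder over the remaining factors.\<close>

lemma measure_single_edge:
  assumes e: "e \<in> edges d" and B: "B \<in> sets (percolation d p)"
    and inv: "\<And>w b. w \<in> space (percolation d p) \<Longrightarrow> w(e := b) \<in> B \<longleftrightarrow> w \<in> B"
  shows "measure (percolation d p) {w \<in> B. w e = b} =
    measure (measure_pmf (bernoulli_pmf (p (direction d e)))) {b} * measure (percolation d p) B"
proof -
  define Me where "Me = (\<lambda>e. measure_pmf (bernoulli_pmf (p (direction d e))))"
  define J where "J = edges d - {e}"
  have J: "insert e J = edges d" using e by (auto simp: J_def)
  have M: "percolation d p = PiM (insert e J) Me" by (simp add: percolation_def Me_def J)
  have prob: "prob_space (Me i)" for i by (simp add: Me_def measure_pmf.prob_space_axioms)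
  interpret P: prob_space "PiM J Me" by (intro prob_space_PiM prob)
  interpret E: prob_space "Me e" by (rule prob)
  have upd: "(\<lambda>(x, X). X(e := x)) \<in> Me e \<Otimes>\<^sub>M PiM J Me \<rightarrow>\<^sub>M PiM (insert e J) Me"
    unfolding split_beta by (rule measurable_fun_upd[where J = J]) auto
  have updb: "(\<lambda>X. X(e := True)) \<in> PiM J Me \<rightarrow>\<^sub>M PiM (insert e J) Me"
    by (rule measurable_fun_upd[where J = J]) (auto simp: Me_def)
  \<comment> \<open>The value \<open>True\<close> is arbitrary; by \<open>inv\<close> every section
    of \<open>B\<close> over \<open>e\<close> is this set.\<close>
  define B' where "B' = {X \<in> space (PiM J Me). X(e := True) \<in> B}"
  have B': "B' \<in> sets (PiM J Me)"
    using measurable_sets[OF updb, of B] B by (simp add: B'_def M vimage_def Int_def conj_commute)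
  have key: "measure (percolation d p) {w \<in> B. w e \<in> V} = measure (Me e) V * measure (PiM J Me) B'" for V
  proof -
    have sub: "{w \<in> B. w e \<in> V} \<in> sets (percolation d p)"
    proof -
      have "(\<lambda>w. w e) \<in> percolation d p \<rightarrow>\<^sub>M Me e"
        unfolding M by (rule measurable_component_singleton) simp
      from measurable_sets[OF this, of V] have "(\<lambda>w. w e) -` V \<inter> space (percolation d p) \<in> sets (percolation d p)"
        by (simp add: Me_def)
      from sets.Int[OF B this] show ?thesis
        using sets.sets_into_space[OF B] by (simp add: Int_def vimage_def conj_commute) (smt (verit) Collect_cong subsetD)
    qed
    have "percolation d p = distr (Me e \<Otimes>\<^sub>M PiM J Me) (PiM (insert e J) Me) (\<lambda>(x, X). X(e := x))"
      unfolding M by (rule distr_pair_PiM_eq_PiM[symmetric]) (rule prob)+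
    then have "measure (percolation d p) {w \<in> B. w e \<in> V} = measure (Me e \<Otimes>\<^sub>M PiM J Me)
        ((\<lambda>(x, X). X(e := x)) -` {w \<in> B. w e \<in> V} \<inter> space (Me e \<Otimes>\<^sub>M PiM J Me))"
      using measure_distr[OF upd, of "{w \<in> B. w e \<in> V}"] sub by (simp add: M)
    also have "(\<lambda>(x, X). X(e := x)) -` {w \<in> B. w e \<in> V} \<inter> space (Me e \<Otimes>\<^sub>M PiM J Me) = V \<times> B'"
    proof -
      have *: "X(e := x) \<in> B \<longleftrightarrow> X(e := True) \<in> B" if "X \<in> space (PiM J Me)" for x X
      proof -
        have "X(e := x) \<in> space (percolation d p)"
          using that by (auto simp: M space_PiM PiE_iff extensional_def Me_def)
        from inv[OF this, of True] show ?thesis by simp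
      qed
      show ?thesis
        by (auto simp: B'_def space_pair_measure Me_def dest: *[THEN iffD1, unfolded Me_def]
            intro: *[THEN iffD2, unfolded Me_def])
    qed
    also have "measure (Me e \<Otimes>\<^sub>M PiM J Me) (V \<times> B') = measure (Me e) V * measure (PiM J Me) B'"
      unfolding measure_def
      by (subst P.emeasure_pair_measure_Times) (use B' in \<open>simp_all add: Me_def enn2real_mult\<close>)
    finally show ?thesis .
  qed
  have "measure (percolation d p) B = measure (PiM J Me) B'"
    using key[of UNIV] E.prob_space by (simp add: Me_def)
  then show ?thesis using key[of "{b}"] by (simp add: Me_def)
qed

lemma measure_open_closed:
  assumes "x \<in> Zd d" "i < d" "0 \<le> p i" "p i \<le> 1" and B: "B \<in> sets (percolation d p)"
    and inv: "\<And>w b. w \<in> space (percolation d p) \<Longrightarrow> w(bond x i := b) \<in> B \<longleftrightarrow> w \<in> B"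
  shows "measure (percolation d p) {w \<in> B. w (bond x i)} = p i * measure (percolation d p) B"
    and "measure (percolation d p) {w \<in> B. \<not> w (bond x i)} = (1 - p i) * measure (percolation d p) B"
proof -
  note * = measure_single_edge[OF bond_in_edges[OF assms(1,2)] B inv, simplified direction_bond[OF assms(1,2)]]
  show "measure (percolation d p) {w \<in> B. w (bond x i)} = p i * measure (percolation d p) B"
    using *[of True] assms by (simp add: measure_pmf_single)
  show "measure (percolation d p) {w \<in> B. \<not> w (bond x i)} = (1 - p i) * measure (percolation d p) B"
    using *[of False] assms by (simp add: measure_pmf_single)
qed

section \<open>Projection to the triangular lattice and the exploration process\<close>

definition proj :: "nat \<Rightarrow> (nat \<Rightarrow> nat) \<Rightarrow> point \<Rightarrow> int \<times> int" where
  "proj d f x = (\<Sum>i<d. x i * fst (gen (f i)), \<Sum>i<d. x i * snd (gen (f i)))"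

lemma proj_upd:
  assumes "i < d"
  shows "proj d f (x(i := x i + s)) = proj d f x + (s * fst (gen (f i)), s * snd (gen (f i)))"
proof -
  have "(\<Sum>k<d. (x(i := x i + s)) k * g k) = (\<Sum>k<d. x k * g k) + s * g i" for g :: "nat \<Rightarrow> int"
    using assms by (simp add: sum.remove[of "{..<d}" i] algebra_simps)
  then show ?thesis by (simp add: proj_def)
qed

lemma proj_up: "i < d \<Longrightarrow> proj d f (x(i := x i + 1)) = proj d f x + gen (f i)"
  by (simp add: proj_upd)

type_synonym state = "point set \<times> ((int \<times> int) \<times> nat) set"

text \<open>A state consists of the points reached so far and of the pairs \<open>(proj d f x, i)\<close> for the
  bonds \<open>bond x i\<close> examined so far. At most one bond is examined for each pair.\<close>

definition candidates :: "nat \<Rightarrow> (nat \<Rightarrow> nat) \<Rightarrow> state \<Rightarrow> (point \<times> nat) set" where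
  "candidates d f \<sigma> = {(x, i). i < d \<and> x \<in> Zd d \<and> (x \<in> fst \<sigma> \<or> x(i := x i + 1) \<in> fst \<sigma>) \<and>
     (proj d f x, f i) \<in> boundary (proj d f ` fst \<sigma>) \<and> (proj d f x, i) \<notin> snd \<sigma>}"

definition examine :: "nat \<Rightarrow> (nat \<Rightarrow> nat) \<Rightarrow> point \<times> nat \<Rightarrow> bool \<Rightarrow> state \<Rightarrow> state" where
  "examine d f c b \<sigma> = (if b then fst \<sigma> \<union> bond (fst c) (snd c) else fst \<sigma>,
     insert (proj d f (fst c), snd c) (snd \<sigma>))"

text \<open>The choice depends on the state alone, so the next bond is determined by what has been
  seen. A state without candidates is a fixed point, which encodes halting.\<close>

definition step :: "nat \<Rightarrow> (nat \<Rightarrow> nat) \<Rightarrow> (point set \<Rightarrow> bool) \<Rightarrow> state \<Rightarrow> state" where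
  "step d f w \<sigma> = (if candidates d f \<sigma> = {} then \<sigma> else
     let c = (SOME c. c \<in> candidates d f \<sigma>) in examine d f c (w (bond (fst c) (snd c))) \<sigma>)"

text \<open>Recursion from the front, with a free initial state, lets inductions condition on the
  first bond examined.\<close>

primrec run :: "nat \<Rightarrow> (nat \<Rightarrow> nat) \<Rightarrow> nat \<Rightarrow> (point set \<Rightarrow> bool) \<Rightarrow> state \<Rightarrow> state" where
  "run d f 0 w \<sigma> = \<sigma>"
| "run d f (Suc n) w \<sigma> = run d f n w (step d f w \<sigma>)"

lemma step_cases:
  obtains "candidates d f \<sigma> = {}" "\<And>w. step d f w \<sigma> = \<sigma>"
  | x i where "(x, i) \<in> candidates d f \<sigma>" "\<And>w. step d f w \<sigma> = examine d f (x, i) (w (bond x i)) \<sigma>"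
proof (cases "candidates d f \<sigma> = {}")
  case True
  then show thesis using that(1) by (simp add: step_def)
next
  case False
  then have "(SOME c. c \<in> candidates d f \<sigma>) \<in> candidates d f \<sigma>" by (meson ex_in_conv someI_ex)
  then show thesis
    using False that(2)[of "fst (SOME c. c \<in> candidates d f \<sigma>)" "snd (SOME c. c \<in> candidates d f \<sigma>)"]
    by (simp add: step_def Let_def)
qed

lemma run_mono: "fst \<sigma> \<subseteq> fst (run d f n w \<sigma>)"
proof (induction n arbitrary: \<sigma>)
  case (Suc n)
  have "fst \<sigma> \<subseteq> fst (step d f w \<sigma>)"
    by (rule step_cases[of d f \<sigma>]) (auto simp: examine_def)
  then show ?case using Suc[of "step d f w \<sigma>"] by auto
qed simp

lemma run_measurable:
  "{w \<in> space (percolation d p). R (run d f n w \<sigma>)} \<in> sets (percolation d p)"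
proof (induction n arbitrary: \<sigma>)
  case (Suc n)
  show ?case
  proof (rule step_cases[of d f \<sigma>])
    assume "\<And>w. step d f w \<sigma> = \<sigma>"
    then show ?case using Suc by simp
  next
    fix x i assume xi: "(x, i) \<in> candidates d f \<sigma>"
      "\<And>w. step d f w \<sigma> = examine d f (x, i) (w (bond x i)) \<sigma>"
    let ?M = "percolation d p" and ?A = "\<lambda>b. {w \<in> space (percolation d p). R (run d f n w (examine d f (x, i) b \<sigma>))}"
    let ?O = "{w \<in> space (percolation d p). w (bond x i)}"
    have "?O \<in> sets ?M" using xi(1) by (intro open_edge_measurable bond_in_edges) (auto simp: candidates_def)
    then have "(?A True \<inter> ?O) \<union> (?A False - ?O) \<in> sets ?M" using Suc by blast
    also have "(?A True \<inter> ?O) \<union> (?A False - ?O) = {w \<in> space ?M. R (run d f (Suc n) w \<sigma>)}"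
      by (auto simp: xi(2)) (metis (full_types))+
    finally show ?case .
  qed
qed simp

text \<open>Recorded keys are never candidates again, so no bond with such a key is looked at. This
  is the invariance that independence requires.\<close>

lemma run_irrelevant:
  assumes "(proj d f x, i) \<in> snd \<sigma>"
  shows "run d f n (w(bond x i := b)) \<sigma> = run d f n w \<sigma>"
  using assms
proof (induction n arbitrary: \<sigma>)
  case (Suc n)
  have "step d f (w(bond x i := b)) \<sigma> = step d f w \<sigma>"
  proof (rule step_cases[of d f \<sigma>])
    fix y k assume yk: "(y, k) \<in> candidates d f \<sigma>"
      "\<And>w. step d f w \<sigma> = examine d f (y, k) (w (bond y k)) \<sigma>"
    then have "bond y k \<noteq> bond x i" using Suc.prems by (auto simp: candidates_def bond_eq_iff)
    then show ?thesis by (simp add: yk(2))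
  qed simp
  moreover have "(proj d f x, i) \<in> snd (step d f w \<sigma>)"
    using Suc.prems by (rule_tac step_cases[of d f \<sigma>]) (auto simp: examine_def)
  ultimately show ?case using Suc.IH by (simp only: run.simps)
qed simp

definition keys :: "nat \<Rightarrow> (nat \<Rightarrow> nat) \<Rightarrow> tri_edge set \<Rightarrow> ((int \<times> int) \<times> nat) set" where
  "keys d f \<Gamma> = {(v, i). i < d \<and> (v, f i) \<in> \<Gamma>}"

text \<open>A bond found open during the run leaves both projected ends in the image, so its edge is
  no longer on the boundary; for keys examined during the run, being blocked thus means having been
  found closed.\<close>

definition blocked :: "nat \<Rightarrow> (nat \<Rightarrow> nat) \<Rightarrow> tri_edge set \<Rightarrow> state \<Rightarrow> bool" where
  "blocked d f \<Gamma> \<sigma> \<longleftrightarrow> \<Gamma> \<subseteq> boundary (proj d f ` fst \<sigma>) \<and> keys d f \<Gamma> \<subseteq> snd \<sigma>"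

lemma finite_keys: assumes "finite \<Gamma>" shows "finite (keys d f \<Gamma>)"
proof (rule finite_subset)
  show "keys d f \<Gamma> \<subseteq> fst ` \<Gamma> \<times> {..<d}" by (force simp: keys_def)
qed (use assms in simp)

text \<open>Condition on the first bond examined. If its key belongs to \<Gamma>, the open outcome
  rules out blocking for good since the reached set only grows, and the closed outcome costs
  \<open>1 - p i\<close> and uses up the key. Any other key leaves the product as it is under both
  outcomes.\<close>

lemma measure_blocked_le:
  assumes p: "\<And>i. i < d \<Longrightarrow> 0 \<le> p i \<and> p i \<le> 1" and "finite \<Gamma>"
  shows "measure (percolation d p) {w \<in> space (percolation d p). blocked d f \<Gamma> (run d f n w \<sigma>)}
    \<le> (\<Prod>\<kappa>\<in>keys d f \<Gamma> - snd \<sigma>. 1 - p (snd \<kappa>))"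
proof (induction n arbitrary: \<sigma>)
  interpret prob_space "percolation d p" by (rule prob_space_percolation)
  case 0
  show ?case
  proof (cases "blocked d f \<Gamma> \<sigma>")
    case True
    then have "keys d f \<Gamma> - snd \<sigma> = {}" by (auto simp: blocked_def)
    then have "(\<Prod>\<kappa>\<in>keys d f \<Gamma> - snd \<sigma>. 1 - p (snd \<kappa>)) = 1" by (simp only: prod.empty)
    then show ?thesis by (simp only: prob_le_1)
  next
    case False
    have "0 \<le> (\<Prod>\<kappa>\<in>keys d f \<Gamma> - snd \<sigma>. 1 - p (snd \<kappa>))"
      by (intro prod_nonneg) (auto simp: keys_def p)
    then show ?thesis using False by simp
  qed
next
  interpret prob_space "percolation d p" by (rule prob_space_percolation)
  let ?M = "percolation d p"
  case (Suc n)
  show ?case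
  proof (rule step_cases[of d f \<sigma>])
    assume "\<And>w. step d f w \<sigma> = \<sigma>"
    then show ?thesis using Suc by simp
  next
    fix x i assume xi: "(x, i) \<in> candidates d f \<sigma>"
      "\<And>w. step d f w \<sigma> = examine d f (x, i) (w (bond x i)) \<sigma>"
    define \<sigma>' where "\<sigma>' b = examine d f (x, i) b \<sigma>" for b
    define A where "A b = {w \<in> space ?M. blocked d f \<Gamma> (run d f n w (\<sigma>' b))}" for b
    define \<kappa>0 where "\<kappa>0 = (proj d f x, i)"
    define \<pi> where "\<pi> K = (\<Prod>\<kappa>\<in>K. 1 - p (snd \<kappa>))" for K :: "((int \<times> int) \<times> nat) set"
    have x: "x \<in> Zd d" "i < d" "\<kappa>0 \<notin> snd \<sigma>" using xi(1) by (auto simp: candidates_def \<kappa>0_def)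
    have snd': "snd (\<sigma>' b) = insert \<kappa>0 (snd \<sigma>)" for b by (simp add: \<sigma>'_def examine_def \<kappa>0_def)
    have Am: "A b \<in> sets ?M" for b unfolding A_def by (rule run_measurable)
    have inv: "w(bond x i := b) \<in> A b' \<longleftrightarrow> w \<in> A b'" if "w \<in> space ?M" for w b b'
      using that space_percolation_upd[OF that bond_in_edges[OF x(1,2)], of b]
        run_irrelevant[of d f x i "\<sigma>' b'" n w b] snd'[of b']
      by (simp add: A_def \<kappa>0_def)
    have "{w \<in> space ?M. blocked d f \<Gamma> (run d f (Suc n) w \<sigma>)}
        = {w \<in> A True. w (bond x i)} \<union> {w \<in> A False. \<not> w (bond x i)}"
      by (auto simp: A_def xi(2) \<sigma>'_def) (metis (full_types))+
    also have "prob \<dots> \<le> prob {w \<in> A True. w (bond x i)} + prob {w \<in> A False. \<not> w (bond x i)}"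
    proof (rule measure_Un_le)
      have O: "{w \<in> space ?M. w (bond x i)} \<in> sets ?M"
        by (intro open_edge_measurable bond_in_edges x)
      have "{w \<in> A True. w (bond x i)} = A True \<inter> {w \<in> space ?M. w (bond x i)}"
        "{w \<in> A False. \<not> w (bond x i)} = A False - {w \<in> space ?M. w (bond x i)}"
        by (auto simp: A_def)
      then show "{w \<in> A True. w (bond x i)} \<in> sets ?M" "{w \<in> A False. \<not> w (bond x i)} \<in> sets ?M"
        using Am O by auto
    qed
    also have "\<dots> = p i * prob (A True) + (1 - p i) * prob (A False)"
      using measure_open_closed[OF x(1,2) _ _ Am inv] p[OF x(2)] by simp
    also have "\<dots> \<le> \<pi> (keys d f \<Gamma> - snd \<sigma>)"
    proof (cases "\<kappa>0 \<in> keys d f \<Gamma>")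
      case True
      have "\<not> blocked d f \<Gamma> (run d f n w (\<sigma>' True))" for w
      proof
        assume "blocked d f \<Gamma> (run d f n w (\<sigma>' True))"
        then have "(proj d f x, f i) \<in> boundary (proj d f ` fst (run d f n w (\<sigma>' True)))"
          using True by (auto simp: blocked_def keys_def \<kappa>0_def)
        moreover have "x \<in> fst (run d f n w (\<sigma>' True))" "x(i := x i + 1) \<in> fst (run d f n w (\<sigma>' True))"
          using run_mono[of "\<sigma>' True" d f n w] by (auto simp: \<sigma>'_def examine_def bond_def)
        then have "proj d f x \<in> proj d f ` fst (run d f n w (\<sigma>' True))"
          "proj d f x + gen (f i) \<in> proj d f ` fst (run d f n w (\<sigma>' True))"
          by (auto simp: proj_up[OF x(2), symmetric])
        ultimately show False by (simp add: boundary_def)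
      qed
      then have "A True = {}" by (simp add: A_def)
      then have "p i * prob (A True) + (1 - p i) * prob (A False) \<le> (1 - p i) * \<pi> (keys d f \<Gamma> - snd (\<sigma>' False))"
      proof -
        have "prob (A False) \<le> \<pi> (keys d f \<Gamma> - snd (\<sigma>' False))"
          using Suc[of "\<sigma>' False"] by (simp add: A_def \<pi>_def)
        then show ?thesis using p[OF x(2)] \<open>A True = {}\<close> by (simp add: mult_left_mono)
      qed
      also have "\<dots> = \<pi> (keys d f \<Gamma> - snd \<sigma>)"
      proof -
        have "keys d f \<Gamma> - snd \<sigma> = insert \<kappa>0 (keys d f \<Gamma> - snd (\<sigma>' False))"
          using True x by (auto simp: snd')
        moreover have fin: "finite (keys d f \<Gamma> - snd (\<sigma>' False))" using finite_keys[OF \<open>finite \<Gamma>\<close>] by blast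
        moreover have new: "\<kappa>0 \<notin> keys d f \<Gamma> - snd (\<sigma>' False)" by (simp add: snd')
        ultimately have "\<pi> (keys d f \<Gamma> - snd \<sigma>) = (1 - p (snd \<kappa>0)) * \<pi> (keys d f \<Gamma> - snd (\<sigma>' False))"
          unfolding \<pi>_def by (simp only: prod.insert[OF fin new])
        then show ?thesis by (simp add: \<kappa>0_def)
      qed
      finally show ?thesis .
    next
      case False
      then have "keys d f \<Gamma> - snd (\<sigma>' b) = keys d f \<Gamma> - snd \<sigma>" for b by (auto simp: snd')
      then have "prob (A b) \<le> \<pi> (keys d f \<Gamma> - snd \<sigma>)" for b
        using Suc[of "\<sigma>' b"] by (simp add: A_def \<pi>_def)
      then have "p i * prob (A True) + (1 - p i) * prob (A False)
          \<le> p i * \<pi> (keys d f \<Gamma> - snd \<sigma>) + (1 - p i) * \<pi> (keys d f \<Gamma> - snd \<sigma>)"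
        using p[OF x(2)] by (intro add_mono mult_left_mono) auto
      then show ?thesis by (simp add: algebra_simps)
    qed
    finally show ?thesis by (simp add: \<pi>_def)
  qed
qed

section \<open>Peierls argument\<close>

lemma run_Suc: "run d f (Suc n) w \<sigma> = step d f w (run d f n w \<sigma>)"
  by (induction n arbitrary: \<sigma>) simp_all

lemma run_finite_Zd:
  assumes "finite (fst \<sigma>)" "fst \<sigma> \<subseteq> Zd d"
  shows "finite (fst (run d f n w \<sigma>)) \<and> fst (run d f n w \<sigma>) \<subseteq> Zd d"
  using assms
proof (induction n arbitrary: \<sigma>)
  case (Suc n)
  have "finite (fst (step d f w \<sigma>)) \<and> fst (step d f w \<sigma>) \<subseteq> Zd d"
  proof (rule step_cases[of d f \<sigma>])
    fix x i assume xi: "(x, i) \<in> candidates d f \<sigma>"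
      "\<And>w. step d f w \<sigma> = examine d f (x, i) (w (bond x i)) \<sigma>"
    then have "bond x i \<subseteq> Zd d" by (auto simp: candidates_def bond_def Zd_upd)
    then show ?thesis using Suc.prems by (auto simp: xi(2) examine_def bond_def)
  qed (use Suc.prems in simp)
  then show ?case using Suc.IH by simp
qed simp

lemma connected_by_open_extend:
  assumes "connected_by_open d w x y" "{y, z} \<in> edges d" "w {y, z}"
  shows "connected_by_open d w x z"
proof -
  obtain n v where "v 0 = x" "v n = y" "\<forall>j<n. {v j, v (Suc j)} \<in> edges d \<and> w {v j, v (Suc j)}"
    using assms(1) by (auto simp: connected_by_open_def)
  then show ?thesis
    unfolding connected_by_open_def using assms(2,3)
    by (intro exI[of _ "Suc n"] exI[of _ "v(Suc n := z)"]) (auto simp: less_Suc_eq)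
qed

lemma bond_subset_cluster:
  assumes "x \<in> Zd d" "i < d" "w (bond x i)" "x \<in> cluster d w \<or> x(i := x i + 1) \<in> cluster d w"
  shows "bond x i \<subseteq> cluster d w"
proof -
  have e: "{x, x(i := x i + 1)} \<in> edges d" "w {x, x(i := x i + 1)}"
    using bond_in_edges[OF assms(1,2)] assms(3) by (auto simp: bond_def)
  then have "{x(i := x i + 1), x} \<in> edges d" "w {x(i := x i + 1), x}" by (simp_all add: insert_commute)
  with e assms(1,4) connected_by_open_extend[of d w origin] show ?thesis
    by (auto simp: bond_def cluster_def Zd_upd assms(2))
qed

lemma origin_in_cluster: "origin \<in> cluster d w"
  by (auto simp: cluster_def connected_by_open_def Zd_def origin_def intro!: exI[of _ 0])

text \<open>The reached set stays inside the cluster, so only keys of bonds touching the cluster are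
  examined. They are finitely many and each is used once.\<close>

lemma exists_halting_time:
  assumes "finite (cluster d w)" "fst \<sigma> \<subseteq> cluster d w"
  shows "\<exists>n. candidates d f (run d f n w \<sigma>) = {}"
proof -
  define C where "C = cluster d w"
  define T where "T = (\<lambda>(x, i). (proj d f x, i)) ` {(x, i). i < d \<and> (x \<in> C \<or> x(i := x i + 1) \<in> C)}"
  have "{(x, i). i < d \<and> (x \<in> C \<or> x(i := x i + 1) \<in> C)}
      \<subseteq> C \<times> {..<d} \<union> (\<lambda>(x, i). (x(i := x i - 1), i)) ` (C \<times> {..<d})"
    by (force simp: image_iff)
  moreover have "finite (C \<times> {..<d} \<union> (\<lambda>(x, i). (x(i := x i - 1), i)) ` (C \<times> {..<d}))"
    using assms(1) by (simp add: C_def)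
  ultimately have "finite {(x, i). i < d \<and> (x \<in> C \<or> x(i := x i + 1) \<in> C)}" by (rule finite_subset)
  then have T: "finite T" unfolding T_def by (rule finite_imageI)
  have "fst \<sigma> \<subseteq> C" using assms(2) by (simp add: C_def)
  then show ?thesis
  proof (induction "card (T - snd \<sigma>)" arbitrary: \<sigma> rule: less_induct)
    case less
    show ?case
    proof (rule step_cases[of d f \<sigma>])
      assume "candidates d f \<sigma> = {}"
      then show ?thesis by (intro exI[of _ 0]) simp
    next
      fix x i assume xi: "(x, i) \<in> candidates d f \<sigma>"
        "\<And>w. step d f w \<sigma> = examine d f (x, i) (w (bond x i)) \<sigma>"
      have x: "i < d" "x \<in> Zd d" "x \<in> C \<or> x(i := x i + 1) \<in> C" "(proj d f x, i) \<notin> snd \<sigma>"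
        using xi(1) less.prems by (auto simp: candidates_def)
      have "(proj d f x, i) \<in> T - snd \<sigma>"
        using x by (auto simp: T_def)
      then have "T - snd (step d f w \<sigma>) \<subset> T - snd \<sigma>" by (auto simp: xi(2) examine_def)
      then have "card (T - snd (step d f w \<sigma>)) < card (T - snd \<sigma>)" using T by (intro psubset_card_mono) auto
      moreover have "fst (step d f w \<sigma>) \<subseteq> C"
        using less.prems bond_subset_cluster[OF x(2,1), of w] x(3) by (auto simp: xi(2) examine_def C_def)
      ultimately obtain n where "candidates d f (run d f n w (step d f w \<sigma>)) = {}"
        using less.hyps by blast
      then show ?thesis by (intro exI[of _ "Suc n"]) simp
    qed
  qed
qed

section \<open>The initial open segment\<close>

definition axis_point :: "nat \<Rightarrow> nat \<Rightarrow> point" where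
  "axis_point i k = origin(i := int k)"

lemma axis_point_Zd: "i < d \<Longrightarrow> axis_point i k \<in> Zd d"
  by (simp add: axis_point_def Zd_def origin_def)

lemma axis_point_up: "(axis_point i k)(i := axis_point i k i + 1) = axis_point i (Suc k)"
  by (simp add: axis_point_def add.commute)

lemma axis_point_eq_iff: "axis_point i k = axis_point i l \<longleftrightarrow> k = l"
  by (auto simp: axis_point_def dest: fun_cong[of _ _ i])

lemma proj_axis_point:
  assumes "i < d" "f i = 0"
  shows "proj d f (axis_point i k) = (int k, 0)"
proof -
  have "axis_point i k = origin(i := origin i + int k)" by (simp add: axis_point_def origin_def)
  then show ?thesis using proj_upd[OF assms(1), of f origin "int k"] assms(2)
    by (simp add: gen_def) (simp add: proj_def origin_def zero_prod_def)
qed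

text \<open>The keys of the segment are recorded beforehand, so the run never looks at its bonds and
  is independent of their being open.\<close>

definition axis_state :: "nat \<Rightarrow> nat \<Rightarrow> state" where
  "axis_state i N = (axis_point i ` {..N}, {((int k, 0), i) | k. k < N})"

definition axis_open :: "nat \<Rightarrow> nat \<Rightarrow> (point set \<Rightarrow> bool) \<Rightarrow> bool" where
  "axis_open i N w \<longleftrightarrow> (\<forall>k<N. w (bond (axis_point i k) i))"

lemma axis_open_cluster:
  assumes "i < d" "axis_open i N w"
  shows "fst (axis_state i N) \<subseteq> cluster d w"
proof -
  have "axis_point i k \<in> cluster d w" if "k \<le> N" for k
    using that
  proof (induction k)
    case 0
    show ?case using origin_in_cluster by (simp add: axis_point_def origin_def fun_upd_def)
  next
    case (Suc k)
    then have "bond (axis_point i k) i \<subseteq> cluster d w"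
      using assms by (intro bond_subset_cluster axis_point_Zd) (auto simp: axis_open_def)
    then show ?case by (simp add: bond_def axis_point_up)
  qed
  then show ?thesis by (auto simp: axis_state_def)
qed

lemma measure_axis_open:
  assumes "i < d" "0 \<le> p i" "p i \<le> 1" and B: "B \<in> sets (percolation d p)"
    and inv: "\<And>w b k. k < N \<Longrightarrow> w \<in> space (percolation d p) \<Longrightarrow> w(bond (axis_point i k) i := b) \<in> B \<longleftrightarrow> w \<in> B"
  shows "{w \<in> B. axis_open i N w} \<in> sets (percolation d p) \<and>
    measure (percolation d p) {w \<in> B. axis_open i N w} = p i ^ N * measure (percolation d p) B"
  using inv
proof (induction N)
  case 0
  show ?case using B by (simp add: axis_open_def)
next
  case (Suc N)
  let ?M = "percolation d p" and ?B = "{w \<in> B. axis_open i N w}"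
  have IH: "?B \<in> sets ?M" "measure ?M ?B = p i ^ N * measure ?M B"
    using Suc by auto
  have eq: "{w \<in> B. axis_open i (Suc N) w} = {w \<in> ?B. w (bond (axis_point i N) i)}"
    by (auto simp: axis_open_def less_Suc_eq)
  have inv': "w(bond (axis_point i N) i := b) \<in> ?B \<longleftrightarrow> w \<in> ?B" if "w \<in> space ?M" for w b
  proof -
    have "axis_open i N (w(bond (axis_point i N) i := b)) \<longleftrightarrow> axis_open i N w"
      by (simp add: axis_open_def bond_eq_iff axis_point_eq_iff)
    with Suc.prems[OF _ that, of N b] show ?thesis by (simp only: mem_Collect_eq lessI)
  qed
  have "{w \<in> ?B. w (bond (axis_point i N) i)} = ?B \<inter> {w \<in> space ?M. w (bond (axis_point i N) i)}"
    using sets.sets_into_space[OF B] by auto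
  also have "\<dots> \<in> sets ?M"
    using IH(1) open_edge_measurable[OF bond_in_edges[OF axis_point_Zd[OF assms(1)] assms(1)]] by blast
  finally show ?case
    unfolding eq using measure_open_closed(1)[where p = p, OF axis_point_Zd[OF assms(1)] assms(1-3) IH(1) inv'] IH(2)
    by simp
qed

text \<open>Grouping the keys by their edge collects one factor for each coordinate of the
  group.\<close>

lemma prod_keys:
  assumes "finite \<Gamma>"
  shows "(\<Prod>\<kappa>\<in>keys d f \<Gamma>. 1 - p (snd \<kappa>)) = (\<Prod>\<gamma>\<in>\<Gamma>. closed_weight d p f (snd \<gamma>))"
proof -
  have "keys d f \<Gamma> = (\<lambda>z. (fst (fst z), snd z)) ` (SIGMA \<gamma>:\<Gamma>. {i. i < d \<and> f i = snd \<gamma>})"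
    by (force simp: keys_def image_iff)
  moreover have "inj_on (\<lambda>z. (fst (fst z), snd z)) (SIGMA \<gamma>:\<Gamma>. {i. i < d \<and> f i = snd \<gamma>})"
    by (auto simp: inj_on_def)
  ultimately have "(\<Prod>\<kappa>\<in>keys d f \<Gamma>. 1 - p (snd \<kappa>)) =
      (\<Prod>(\<gamma>, i)\<in>(SIGMA \<gamma>:\<Gamma>. {i. i < d \<and> f i = snd \<gamma>}). 1 - p i)"
    by (simp add: prod.reindex split_beta comp_def)
  also have "\<dots> = (\<Prod>\<gamma>\<in>\<Gamma>. closed_weight d p f (snd \<gamma>))"
    unfolding closed_weight_def using assms by (intro prod.Sigma[symmetric]) auto
  finally show ?thesis .
qed

text \<open>Both ends of a segment edge are reached from the start, so it never lies on the
  boundary. Hence the recorded keys remove no factor from the weight of a contour.\<close>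

lemma axis_boundary_free:
  assumes "i < d" "f i = 0" "blocked d f \<Gamma> (run d f n w (axis_state i N))"
  shows "keys d f \<Gamma> \<inter> snd (axis_state i N) = {}"
proof (rule ccontr)
  let ?L = "fst (run d f n w (axis_state i N))"
  assume "\<not> ?thesis"
  then obtain k where k: "k < N" "((int k, 0), 0) \<in> \<Gamma>"
    using assms(2) by (auto simp: axis_state_def keys_def)
  have "axis_point i k \<in> ?L" "axis_point i (Suc k) \<in> ?L"
    using run_mono[of "axis_state i N" d f n w] k(1) by (auto simp: axis_state_def)
  then have L: "(int k, 0) \<in> proj d f ` ?L" "(int (Suc k), 0) \<in> proj d f ` ?L"
    by (auto simp: proj_axis_point[of i d f, OF assms(1,2), symmetric] simp del: of_nat_Suc)
  have "((int k, 0), 0) \<in> boundary (proj d f ` ?L)"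
    using assms(3) k(2) by (auto simp: blocked_def)
  then have "(int k, 0) + gen 0 \<notin> proj d f ` ?L" using L(1) by (simp add: boundary_def)
  moreover have "(int k, 0) + gen 0 = (int (Suc k), 0)" by (simp add: gen_def)
  ultimately show False using L(2) by metis
qed

lemma measure_axis_blocked_le:
  assumes p: "\<And>i. i < d \<Longrightarrow> 0 \<le> p i \<and> p i \<le> 1" and i: "i < d" "f i = 0" and "finite \<Gamma>"
  shows "measure (percolation d p) {w \<in> space (percolation d p).
      axis_open i N w \<and> blocked d f \<Gamma> (run d f n w (axis_state i N))}
    \<le> p i ^ N * (\<Prod>\<gamma>\<in>\<Gamma>. closed_weight d p f (snd \<gamma>))" (is "measure ?M ?E \<le> ?R")
proof (cases "keys d f \<Gamma> \<inter> snd (axis_state i N) = {}")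
  case True
  define B where "B = {w \<in> space ?M. blocked d f \<Gamma> (run d f n w (axis_state i N))}"
  have B: "B \<in> sets ?M" unfolding B_def by (rule run_measurable)
  have inv: "w(bond (axis_point i k) i := b) \<in> B \<longleftrightarrow> w \<in> B" if "k < N" "w \<in> space ?M" for w b k
  proof -
    have "(proj d f (axis_point i k), i) \<in> snd (axis_state i N)"
      using that(1) by (auto simp: proj_axis_point[of i d f, OF i] axis_state_def)
    then show ?thesis
      using that(2) space_percolation_upd[OF that(2) bond_in_edges[OF axis_point_Zd[OF i(1)] i(1)]]
      by (simp add: B_def run_irrelevant)
  qed
  have "measure ?M ?E = measure ?M {w \<in> B. axis_open i N w}"
    by (rule arg_cong[where f = "measure ?M"]) (auto simp: B_def)
  also have "\<dots> = p i ^ N * measure ?M B"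
    using measure_axis_open[where p = p, OF i(1) _ _ B inv] p[OF i(1)] by blast
  also have "\<dots> \<le> p i ^ N * (\<Prod>\<kappa>\<in>keys d f \<Gamma> - snd (axis_state i N). 1 - p (snd \<kappa>))"
    unfolding B_def using p i by (intro mult_left_mono measure_blocked_le assms) auto
  also have "keys d f \<Gamma> - snd (axis_state i N) = keys d f \<Gamma>" using True by blast
  finally show ?thesis by (simp add: prod_keys[OF \<open>finite \<Gamma>\<close>])
next
  case False
  then have E: "?E = {}" using axis_boundary_free[of i d f] i by blast
  have "0 \<le> (\<Prod>\<gamma>\<in>\<Gamma>. closed_weight d p f (snd \<gamma>))"
    unfolding closed_weight_def by (intro prod_nonneg) (auto simp: p)
  then show ?thesis unfolding E using p[OF i(1)] by simp
qed

text \<open>A boundary edge has one end in the projected set. A reached point over that end carries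
  a bond over the edge in every direction of the group; without candidates, each such key must have
  been examined.\<close>

lemma halted_blocked:
  assumes "finite (fst \<sigma>)" "fst \<sigma> \<subseteq> Zd d" "candidates d f \<sigma> = {}" "\<Gamma> \<subseteq> boundary (proj d f ` fst \<sigma>)"
  shows "blocked d f \<Gamma> \<sigma>"
proof -
  have "(v, i) \<in> snd \<sigma>" if "(v, i) \<in> keys d f \<Gamma>" for v i
  proof (rule ccontr)
    assume new: "(v, i) \<notin> snd \<sigma>"
    have i: "i < d" "(v, f i) \<in> boundary (proj d f ` fst \<sigma>)"
      using that assms(4) by (auto simp: keys_def)
    then consider "v \<in> proj d f ` fst \<sigma>" | "v + gen (f i) \<in> proj d f ` fst \<sigma>"
      by (auto simp: boundary_def)
    then show False
    proof cases
      case 1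
      then obtain x where x: "v = proj d f x" "x \<in> fst \<sigma>" by auto
      then have "(x, i) \<in> candidates d f \<sigma>"
        using i new assms(2) by (auto simp: candidates_def)
      then show False using assms(3) by simp
    next
      case 2
      then obtain y where y: "v + gen (f i) = proj d f y" "y \<in> fst \<sigma>" by auto
      define x where "x = y(i := y i - 1)"
      have yx: "y = x(i := x i + 1)" by (simp add: x_def)
      have "proj d f x + gen (f i) = v + gen (f i)"
        using y(1) proj_up[OF i(1), of f x] by (simp flip: yx)
      then have "proj d f x = v" by simp
      moreover have "x \<in> Zd d" using y(2) assms(2) i(1) by (auto simp: x_def Zd_upd)
      ultimately have "(x, i) \<in> candidates d f \<sigma>"
        using i new y(2) by (simp add: candidates_def flip: yx)
      then show False using assms(3) by simp
    qed
  qed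
  then show ?thesis using assms(4) by (auto simp: blocked_def)
qed

lemma measure_axis_halted_le:
  assumes p: "\<And>i. i < d \<Longrightarrow> 0 \<le> p i \<and> p i \<le> 1" and i: "i < d" "f i = 0"
    and mu: "\<mu> = (\<Sum>j<3. closed_weight d p f j / (1 + closed_weight d p f j))" "\<mu> < 1"
  shows "measure (percolation d p) {w \<in> space (percolation d p).
      axis_open i N w \<and> candidates d f (run d f n w (axis_state i N)) = {}}
    \<le> p i ^ N * (4 * \<mu> ^ N / (1 - \<mu>))" (is "measure ?M ?E \<le> _")
proof -
  interpret prob_space ?M by (rule prob_space_percolation)
  define W where "W = closed_weight d p f"
  have W: "0 \<le> W j" "W j \<le> 1" for j
    unfolding W_def closed_weight_def by (auto intro!: prod_nonneg prod_le_1 simp: p)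
  have muW: "\<mu> = (\<Sum>j<3. W j / (1 + W j))" by (simp add: mu W_def)
  have mu0: "0 \<le> \<mu>" unfolding muW using W by (intro sum_nonneg divide_nonneg_nonneg add_nonneg_nonneg) auto
  have pN: "0 \<le> p i ^ N" using p[OF i(1)] by simp
  \<comment> \<open>Distinctness is part of the event because a repeated edge would count twice in
    the list product but once in \<open>set l\<close>; for such lists the event is empty.\<close>
  define C where "C l = {w \<in> space ?M. axis_open i N w \<and> blocked d f (set l) (run d f n w (axis_state i N)) \<and> distinct l}" for l
  \<comment> \<open>The length fixes the starting edge, so only the type of the first triangle is
    left to sum over; two types times the factor 2 of the walk estimate give the 4.\<close>
  define V where "V m = (SIGMA b:UNIV. walks (N + m) ((int (N + m), 0), 0) b)" for m
  have finV: "finite (V m)" for m unfolding V_def by (intro finite_SigmaI finite_walks) simp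
  have open_meas: "{w \<in> B. axis_open i N w} \<in> sets ?M" if "B \<in> sets ?M" for B
  proof -
    have "{w \<in> space ?M. axis_open i N w} \<in> sets ?M"
      using measure_axis_open[where p = p and B = "space ?M", OF i(1)] p[OF i(1)]
        space_percolation_upd[OF _ bond_in_edges[OF axis_point_Zd[OF i(1)] i(1)]] by blast
    then have "B \<inter> {w \<in> space ?M. axis_open i N w} \<in> sets ?M" using that by blast
    moreover have "B \<inter> {w \<in> space ?M. axis_open i N w} = {w \<in> B. axis_open i N w}"
      using sets.sets_into_space[OF that] by auto
    ultimately show ?thesis by simp
  qed
  have Cm: "C l \<in> sets ?M" for l
  proof -
    have "C l = {w \<in> {w \<in> space ?M. blocked d f (set l) (run d f n w (axis_state i N)) \<and> distinct l}. axis_open i N w}"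
      by (auto simp: C_def)
    also have "\<dots> \<in> sets ?M" by (intro open_meas run_measurable)
    finally show ?thesis .
  qed
  have Cle: "prob (C l) \<le> p i ^ N * (\<Prod>\<gamma>\<leftarrow>l. W (snd \<gamma>))" for l
  proof (cases "distinct l")
    case True
    have "prob (C l) \<le> p i ^ N * (\<Prod>\<gamma>\<in>set l. W (snd \<gamma>))"
      using measure_axis_blocked_le[where p = p and f = f, OF p i, of "set l" N n] True by (simp add: C_def W_def)
    then show ?thesis using True by (simp add: prod.distinct_set_conv_list)
  next
    case False
    have "0 \<le> (\<Prod>\<gamma>\<leftarrow>l. W (snd \<gamma>))" by (rule prod_list_nonneg) (auto simp: W)
    then show ?thesis using False pN by (simp add: C_def)
  qed
  have Em: "prob (\<Union>v\<in>V m. C (snd v)) \<le> p i ^ N * (4 * \<mu> ^ (N + m))" for m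
  proof -
    have "prob (\<Union>v\<in>V m. C (snd v)) \<le> (\<Sum>v\<in>V m. prob (C (snd v)))"
      using finV Cm by (intro finite_measure_subadditive_finite) auto
    also have "\<dots> \<le> (\<Sum>v\<in>V m. p i ^ N * (\<Prod>\<gamma>\<leftarrow>snd v. W (snd \<gamma>)))"
      by (intro sum_mono Cle)
    also have "\<dots> = p i ^ N * (\<Sum>b\<in>UNIV. \<Sum>l\<in>walks (N + m) ((int (N + m), 0), 0) b. \<Prod>\<gamma>\<leftarrow>l. W (snd \<gamma>))"
      unfolding V_def by (subst sum.Sigma) (auto simp: finite_walks sum_distrib_left split_beta)
    also have "\<dots> \<le> p i ^ N * (\<Sum>b\<in>(UNIV :: bool set). 2 * \<mu> ^ (N + m))"
    proof (intro mult_left_mono sum_mono pN)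
      fix b :: bool
      have "(\<Sum>l\<in>walks (N + m) ((int (N + m), 0), 0) b. \<Prod>\<gamma>\<leftarrow>l. W (snd \<gamma>)) \<le> 2 * \<mu> ^ (N + m) / (1 + W 0)"
        using sum_walk_weights[of W \<mu> "((int (N + m), 0), 0)" "N + m" b] W muW mu(2) by simp
      also have "\<dots> \<le> 2 * \<mu> ^ (N + m)"
        using divide_left_mono[of 1 "1 + W 0" "2 * \<mu> ^ (N + m)"] W(1)[of 0] mu0 by simp
      finally show "(\<Sum>l\<in>walks (N + m) ((int (N + m), 0), 0) b. \<Prod>\<gamma>\<leftarrow>l. W (snd \<gamma>)) \<le> 2 * \<mu> ^ (N + m)" .
    qed
    finally show ?thesis by (simp add: UNIV_bool)
  qed
  have geo: "(\<lambda>m. p i ^ N * (4 * \<mu> ^ (N + m))) sums (p i ^ N * (4 * \<mu> ^ N / (1 - \<mu>)))"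
  proof -
    have "(\<lambda>m. \<mu> ^ m) sums (1 / (1 - \<mu>))" using mu0 mu(2) by (intro geometric_sums) simp
    from sums_mult[OF this, of "p i ^ N * (4 * \<mu> ^ N)"] show ?thesis
      by (simp add: power_add mult_ac)
  qed
  have summ: "summable (\<lambda>m. prob (\<Union>v\<in>V m. C (snd v)))"
    by (rule summable_comparison_test'[OF sums_summable[OF geo], of 0]) (use Em in simp)
  have "?E \<subseteq> (\<Union>m. \<Union>v\<in>V m. C (snd v))"
  proof
    fix w assume w: "w \<in> ?E"
    define \<sigma> where "\<sigma> = run d f n w (axis_state i N)"
    have \<sigma>: "finite (fst \<sigma>)" "fst \<sigma> \<subseteq> Zd d"
      unfolding \<sigma>_def using run_finite_Zd[of "axis_state i N" d f n w] axis_point_Zd[OF i(1)]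
      by (auto simp: axis_state_def)
    have "(int k, 0) \<in> proj d f ` fst \<sigma>" if "k \<le> N" for k
      using run_mono[of "axis_state i N" d f n w] that
      by (auto simp: \<sigma>_def axis_state_def proj_axis_point[of i d f, OF i, symmetric])
    then obtain m b l where l: "m \<ge> N" "l \<in> walks m ((int m, 0), 0) b" "distinct l"
        "set l \<subseteq> boundary (proj d f ` fst \<sigma>)"
      using exists_boundary_walk[of "proj d f ` fst \<sigma>" N] \<sigma> by (metis finite_imageI)
    have "blocked d f (set l) \<sigma>" using halted_blocked[OF \<sigma> _ l(4)] w by (simp add: \<sigma>_def)
    then have "w \<in> C l" using w l by (simp add: C_def \<sigma>_def)
    moreover have "(b, l) \<in> V (m - N)" using l by (simp add: V_def)
    ultimately show "w \<in> (\<Union>m. \<Union>v\<in>V m. C (snd v))" by force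
  qed
  moreover have Um: "(\<Union>v\<in>V m. C (snd v)) \<in> sets ?M" for m
    using finV Cm by (intro sets.finite_UN) auto
  ultimately have "prob ?E \<le> prob (\<Union>m. \<Union>v\<in>V m. C (snd v))"
    by (intro finite_measure_mono) auto
  also have "\<dots> \<le> (\<Sum>m. prob (\<Union>v\<in>V m. C (snd v)))"
    using Um summ by (intro finite_measure_subadditive_countably) auto
  also have "\<dots> \<le> p i ^ N * (4 * \<mu> ^ N / (1 - \<mu>))"
    using suminf_le[OF Em summ sums_summable[OF geo]] by (simp only: sums_unique[OF geo, symmetric])
  finally show ?thesis .
qed

theorem theorem2:
  fixes d :: nat and p :: "nat \<Rightarrow> real"
  assumes "d \<ge> 2"
    and "\<And>i. i < d \<Longrightarrow> 0 \<le> p i \<and> p i < 1"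
    and "(\<Sum>i<d. p i) > 3 * ln 2"
  shows "theta d p > 0"
proof -
  let ?M = "percolation d p"
  interpret prob_space ?M by (rule prob_space_percolation)
  have p: "0 \<le> p i \<and> p i \<le> 1" if "i < d" for i using assms(2)[OF that] by simp
  obtain f where f: "closed_weight d p f 0 < 1"
      "(\<Sum>j<3. closed_weight d p f j / (1 + closed_weight d p f j)) < 1"
    using exists_partition[OF assms(2,3)] by metis
  define \<mu> where "\<mu> = (\<Sum>j<3. closed_weight d p f j / (1 + closed_weight d p f j))"
  have mu: "\<mu> < 1" using f(2) by (simp add: \<mu>_def)
  have "\<exists>i<d. f i = 0 \<and> 0 < p i"
  proof (rule ccontr)
    assume "\<not> ?thesis"
    then have "p k = 0" if "k < d" "f k = 0" for k using that p[of k] by force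
    then have "closed_weight d p f 0 = 1" unfolding closed_weight_def by (intro prod.neutral) auto
    then show False using f(1) by simp
  qed
  then obtain i where i: "i < d" "f i = 0" "0 < p i" by blast
  \<comment> \<open>With this \<open>N\<close>, halting on an open segment is strictly less likely
    than the open segment itself.\<close>
  obtain N where "\<mu> ^ N < (1 - \<mu>) / 4" using real_arch_pow_inv[of "(1 - \<mu>) / 4" \<mu>] mu by auto
  then have N: "4 * \<mu> ^ N / (1 - \<mu>) < 1" using mu by (simp add: field_simps)
  define S where "S = {w \<in> space ?M. axis_open i N w}"
  have S: "S \<in> sets ?M" "prob S = p i ^ N"
    using measure_axis_open[where p = p and B = "space ?M" and N = N, OF i(1)] p[OF i(1)]
      space_percolation_upd[OF _ bond_in_edges[OF axis_point_Zd[OF i(1)] i(1)]]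
    by (auto simp: S_def prob_space)
  define H where "H n = {w \<in> space ?M. axis_open i N w \<and> candidates d f (run d f n w (axis_state i N)) = {}}" for n
  have Hm: "H n \<in> sets ?M" for n
  proof -
    have "H n = S \<inter> {w \<in> space ?M. candidates d f (run d f n w (axis_state i N)) = {}}"
      by (auto simp: H_def S_def)
    also have "\<dots> \<in> sets ?M" using S(1) by (intro sets.Int run_measurable)
    finally show ?thesis .
  qed
  \<comment> \<open>A halted exploration stays halted, so the bound, uniform in \<open>n\<close>,
    passes to the union.\<close>
  have "H n \<subseteq> H (Suc n)" for n
  proof -
    have "run d f (Suc n) w (axis_state i N) = run d f n w (axis_state i N)"
      if "candidates d f (run d f n w (axis_state i N)) = {}" for w
      unfolding run_Suc using that by (simp add: step_def)
    then show ?thesis unfolding H_def by (auto simp del: run.simps)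
  qed
  then have "incseq H" by (rule incseq_SucI)
  then have "(\<lambda>n. prob (H n)) \<longlonglongrightarrow> prob (\<Union>n. H n)"
    using Hm by (intro finite_Lim_measure_incseq) auto
  moreover have "prob (H n) \<le> p i ^ N * (4 * \<mu> ^ N / (1 - \<mu>))" for n
    unfolding H_def by (rule measure_axis_halted_le[OF p i(1,2) \<mu>_def mu])
  ultimately have halted: "prob (\<Union>n. H n) \<le> p i ^ N * (4 * \<mu> ^ N / (1 - \<mu>))"
    by (intro LIMSEQ_le_const2) auto
  let ?I = "{w \<in> space ?M. infinite (cluster d w)}"
  \<comment> \<open>On an open segment a finite cluster forces halting, so \<open>S\<close> minus
    the halting events lies in the event of an infinite cluster.\<close>
  have "S \<subseteq> ?I \<union> (\<Union>n. H n)"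
  proof
    fix w assume w: "w \<in> S"
    then have "\<exists>n. w \<in> H n" if "finite (cluster d w)"
      using exists_halting_time[OF that axis_open_cluster[OF i(1)], of N f] by (auto simp: S_def H_def)
    then show "w \<in> ?I \<union> (\<Union>n. H n)" using w by (auto simp: S_def)
  qed
  then have "prob S \<le> prob (?I \<union> (\<Union>n. H n))"
    using Hm measurable_infinite_cluster by (intro finite_measure_mono) auto
  also have "\<dots> \<le> prob ?I + prob (\<Union>n. H n)"
    using Hm measurable_infinite_cluster by (intro measure_Un_le) auto
  finally have "p i ^ N \<le> theta d p + p i ^ N * (4 * \<mu> ^ N / (1 - \<mu>))"
    using halted S(2) by (simp add: theta_def)
  moreover have "p i ^ N * (4 * \<mu> ^ N / (1 - \<mu>)) < p i ^ N * 1"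
    using i(3) N by (intro mult_strict_left_mono) auto
  ultimately show ?thesis by simp
qed

end
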